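(* Let $0<\alpha<1$. Let $u\in C^4([0,L]\times[0,T])$ be the exact solution of the fractal mobile/immobile transport model described in the context, and for positive integers $M,N$ let $(U_i^k)$ be the solution of the Crank–Nicholson finite difference scheme (S) described in the context with $U_i^0=\phi(x_i)$. Put $\mathbf u^k=(u(x_1,t_k),\ldots,u(x_{M-1},t_k))$ and $\mathbf U^k=(U_1^k,\ldots,U_{M-1}^k)$. Then there exists a positive constant $C$, independent of $h$, $k$ and $\tau$, such that $$\|\mathbf u^k-\mathbf U^k\|_2\le C(\tau^2+h^2),\qquad \forall\,1\le k\le N.$$
   Context: Fix $L,T>0$. The fractal mobile/immobile transport model is $$\frac{\partial u}{\partial t}+{}_0^{C}D_t^\alpha u=\frac{\partial^2 u}{\partial x^2}+f(x,t),\quad (x,t)\in[0,L]\times[0,T],$$ with $u(x,0)=\phi(x)$ for $0\le x\le L$ and $u(0,t)=u(L,t)=0$ for $t>0$, where ${}_0^{C}D_t^\alpha u(x,t)=\frac{1}{\Gamma(1-\alpha)}\int_0^t \frac{\partial u}{\partial s}(x,s)(t-s)^{-\alpha}ds$ is the Caputo derivative and $f$ is continuous. Set $\psi(x)=\phi''(x)+f(x,0)$. Grid: $h=L/M$, $x_i=ih$ ($0\le i\le M$), $\tau=T/N$, $t_k=k\tau$ ($0\le k\le N$), $\psi_i=\psi(x_i)$, $f_i^{k+1/2}=f(x_i,(k+\tfrac12)\tau)$. Coefficients: $M_j=(j+1)^{2-\alpha}-j^{2-\alpha}$ for $j\ge0$; $G_{j+1}=M_{j+1}-M_j$ for $j\ge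 0$; $\beta=\dfrac{\tau^{1-\alpha}}{\Gamma(3-\alpha)}$. Scheme (S): $U_0^k=U_M^k=0$ for all $k$, and for $1\le i\le M-1$, $k=0,1,\ldots,N-1$, $$-\frac{\tau}{2h^2}U_{i+1}^{k+1}+\Big(\frac{\tau}{h^2}+1+\beta\Big)U_i^{k+1}-\frac{\tau}{2h^2}U_{i-1}^{k+1}$$ $$=\frac{\tau}{2h^2}U_{i+1}^{k}+\Big(-\frac{\tau}{h^2}+1+\beta-\beta G_1\mathbf 1_{k\ge1}\Big)U_i^{k}+\frac{\tau}{2h^2}U_{i-1}^{k}+\beta\sum_{j=1}^{k-1}(G_{k-j}-G_{k-j+1})U_i^j+\beta G_kU_i^0\,\mathbf 1_{k\ge1}$$ $$\quad+\tau\beta M_k\psi_i+\tau f_i^{k+1/2}-\frac{\tau\psi_i[(k+\frac12)\tau]^{1-\alpha}}{\Gamma(2-\alpha)},$$ where $\mathbf 1_{k\ge1}$ is $1$ if $k\ge1$ and $0$ if $k=0$ (the corresponding terms are absent for $k=0$), and empty sums are $0$. Norm: for $V=(V_1,\ldots,V_{M-1})$, $\|V\|_2=\big(\sum_{i=1}^{M-1}h|V_i|^2\big)^{1/2}$. *)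

theory Defs
  imports "HOL-Analysis.Analysis"
begin

text \<open>
  Functions on the closed rectangle are curried: \<open>u x t\<close> with \<open>x \<in> {0..L}\<close> and \<open>t \<in> {0..T}\<close>.
  Derivatives are taken within the closed interval, so they are one-sided at its end points and
  do not depend on the values outside the interval.
\<close>

definition ivl_deriv :: "real \<Rightarrow> real \<Rightarrow> (real \<Rightarrow> real) \<Rightarrow> real \<Rightarrow> real" where
  "ivl_deriv a b g x = vector_derivative g (at x within {a..b})"

definition dx :: "real \<Rightarrow> (real \<Rightarrow> real \<Rightarrow> real) \<Rightarrow> real \<Rightarrow> real \<Rightarrow> real" where
  "dx L u x t = ivl_deriv 0 L (\<lambda>y. u y t) x"

definition dt :: "real \<Rightarrow> (real \<Rightarrow> real \<Rightarrow> real) \<Rightarrow> real \<Rightarrow> real \<Rightarrow> real" where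
  "dt T u x t = ivl_deriv 0 T (\<lambda>s. u x s) t"

text \<open>
  \<open>C_rect n L T u\<close>: all partial derivatives of \<open>u\<close> up to total order \<open>n\<close>, mixed ones in every
  order of differentiation included, exist and are continuous on \<open>[0,L] \<times> [0,T]\<close>.
\<close>

primrec C_rect :: "nat \<Rightarrow> real \<Rightarrow> real \<Rightarrow> (real \<Rightarrow> real \<Rightarrow> real) \<Rightarrow> bool" where
  "C_rect 0 L T u \<longleftrightarrow> continuous_on ({0..L} \<times> {0..T}) (\<lambda>(x, t). u x t)"
| "C_rect (Suc n) L T u \<longleftrightarrow>
     continuous_on ({0..L} \<times> {0..T}) (\<lambda>(x, t). u x t) \<and>
     (\<forall>x\<in>{0..L}. \<forall>t\<in>{0..T}.
        (\<lambda>y. u y t) differentiable (at x within {0..L}) \<and>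
        (\<lambda>s. u x s) differentiable (at t within {0..T})) \<and>
     C_rect n L T (dx L u) \<and> C_rect n L T (dt T u)"

text \<open>
  At the end point \<open>s = t\<close> the kernel takes the value \<open>0 powr (-\<alpha>) = 0\<close>, which does not affect
  the integral.
\<close>

definition caputo :: "real \<Rightarrow> real \<Rightarrow> (real \<Rightarrow> real \<Rightarrow> real) \<Rightarrow> real \<Rightarrow> real \<Rightarrow> real" where
  "caputo \<alpha> T u x t =
     1 / Gamma (1 - \<alpha>) * integral {0..t} (\<lambda>s. dt T u x s * (t - s) powr (-\<alpha>))"

definition mim_solution ::
  "real \<Rightarrow> real \<Rightarrow> real \<Rightarrow> (real \<Rightarrow> real \<Rightarrow> real) \<Rightarrow> (real \<Rightarrow> real) \<Rightarrow> (real \<Rightarrow> real \<Rightarrow> real) \<Rightarrow> bool" where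
  "mim_solution \<alpha> L T f \<phi> u \<longleftrightarrow>
     (\<forall>x\<in>{0..L}. \<forall>t\<in>{0..T}. dt T u x t + caputo \<alpha> T u x t = dx L (dx L u) x t + f x t) \<and>
     (\<forall>x\<in>{0..L}. u x 0 = \<phi> x) \<and>
     (\<forall>t\<in>{0<..T}. u 0 t = 0 \<and> u L t = 0)"

definition psi :: "real \<Rightarrow> (real \<Rightarrow> real \<Rightarrow> real) \<Rightarrow> (real \<Rightarrow> real) \<Rightarrow> real \<Rightarrow> real" where
  "psi L f \<phi> x = ivl_deriv 0 L (ivl_deriv 0 L \<phi>) x + f x 0"

definition coeff_M :: "real \<Rightarrow> nat \<Rightarrow> real" where
  "coeff_M \<alpha> j = (real j + 1) powr (2 - \<alpha>) - real j powr (2 - \<alpha>)"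

text \<open>Only used for \<open>j \<ge> 1\<close>; the subtraction on the index truncates at \<open>j = 0\<close>.\<close>

definition coeff_G :: "real \<Rightarrow> nat \<Rightarrow> real" where
  "coeff_G \<alpha> j = coeff_M \<alpha> j - coeff_M \<alpha> (j - 1)"

definition beta :: "real \<Rightarrow> real \<Rightarrow> real" where
  "beta \<alpha> \<tau> = \<tau> powr (1 - \<alpha>) / Gamma (3 - \<alpha>)"

text \<open>
  \<open>U i k\<close> is the grid function with space index \<open>i\<close> and time index \<open>k\<close>.
\<close>

definition cn_scheme ::
  "real \<Rightarrow> real \<Rightarrow> real \<Rightarrow> (real \<Rightarrow> real \<Rightarrow> real) \<Rightarrow> (real \<Rightarrow> real) \<Rightarrow> nat \<Rightarrow> nat
    \<Rightarrow> (nat \<Rightarrow> nat \<Rightarrow> real) \<Rightarrow> bool" where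
  "cn_scheme \<alpha> L T f \<phi> M N U \<longleftrightarrow>
    (let h = L / real M; \<tau> = T / real N; \<beta> = beta \<alpha> \<tau>; G = coeff_G \<alpha>;
         \<psi> = (\<lambda>i. psi L f \<phi> (real i * h))
     in
      (\<forall>k\<le>N. U 0 k = 0 \<and> U M k = 0) \<and>
      (\<forall>i k. 1 \<le> i \<and> i \<le> M - 1 \<and> k < N \<longrightarrow>
        - (\<tau> / (2 * h\<^sup>2)) * U (i + 1) (k + 1)
          + (\<tau> / h\<^sup>2 + 1 + \<beta>) * U i (k + 1)
          - \<tau> / (2 * h\<^sup>2) * U (i - 1) (k + 1)
        = \<tau> / (2 * h\<^sup>2) * U (i + 1) k
          + (- (\<tau> / h\<^sup>2) + 1 + \<beta> - (if k \<ge> 1 then \<beta> * G 1 else 0)) * U i k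
          + \<tau> / (2 * h\<^sup>2) * U (i - 1) k
          + \<beta> * (\<Sum>j\<in>{1..<k}. (G (k - j) - G (k - j + 1)) * U i j)
          + (if k \<ge> 1 then \<beta> * G k * U i 0 else 0)
          + \<tau> * \<beta> * coeff_M \<alpha> k * \<psi> i
          + \<tau> * f (real i * h) ((real k + 1/2) * \<tau>)
          - \<tau> * \<psi> i * ((real k + 1/2) * \<tau>) powr (1 - \<alpha>) / Gamma (2 - \<alpha>)))"

definition grid_norm :: "real \<Rightarrow> nat \<Rightarrow> (nat \<Rightarrow> real) \<Rightarrow> real" where
  "grid_norm h M V = sqrt (\<Sum>i = 1..M - 1. h * \<bar>V i\<bar>\<^sup>2)"

end

theory Submission
  imports Defs
begin

text \<open>
  The error \<open>e\<close> solves the scheme with zero data and the truncation error as right-hand side. Testing with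
  \<open>e\<^sub>k\<^sub>+\<^sub>1 + e\<^sub>k\<close> makes the local terms telescope and gives the discrete Laplacian a sign, so stability
  reduces to a lower bound for the quadratic form
  \<open>\<Sum>\<^sub>k (e\<^sub>k\<^sub>+\<^sub>1 + e\<^sub>k) \<Sum>\<^sub>j G\<^sub>k\<^sub>-\<^sub>j (e\<^sub>j\<^sub>+\<^sub>1 - e\<^sub>j)\<close>. Since \<open>G\<close> is nonnegative, decreasing and
  convex, two summations by parts bound it below by \<open>- (G\<^sub>1 - G\<^sub>2 / 2) e\<^sub>K\<^sup>2\<close>, and \<open>G\<^sub>1 - G\<^sub>2 / 2 \<le> 1\<close>.
  Hence the error is at most twice the sum over time of the norms of the truncation errors.

  The truncation error need not be of third order in \<open>\<tau>\<close> at each step because of the weak singularity at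
  \<open>t = 0\<close>; only its sum over time is of second order. The singular contributions are bounded by
  increments of \<open>t powr (1 - \<alpha>)\<close> and \<open>t powr (2 - \<alpha>)\<close>, which telescope.
\<close>

section \<open>Monotonicity and convexity of the coefficients\<close>

text \<open>Two features of the scheme shape the argument. The memory term is an exact increment of
  a fractional integral, while \<open>f\<close> enters by the midpoint rule. Near t = 0 the Caputo
  derivative behaves like \<psi> times \<open>t powr (1 - \<alpha>) / Gamma (2 - \<alpha>)\<close>,
  and for this function the midpoint rule is only of order \<open>\<tau> powr (2 - \<alpha>)\<close>
  in the first step. Here \<psi> is the time derivative of u at t = 0, because the Caputo derivative
  vanishes there; the two \<psi> terms of the scheme are the exact increment and the midpoint value
  for this function, so its error cancels.

  In the energy estimate the increment of the current step sits in the local term with weight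
  \<beta>, apart from the memory sum. Testing turns the local term into \<open>1 + \<beta>\<close>
  times the square at time K, and the defect of the memory form costs at most \<beta> times that
  square. This gives stability without any relation between \<tau> and h. The bound
  \<open>G 1 - G 2 / 2 \<le> 1\<close> becomes an equality as \<alpha> tends to 0, so it cannot be
  replaced by a cruder one.\<close>

primrec diff_powr :: "nat \<Rightarrow> real \<Rightarrow> real \<Rightarrow> real" where
  "diff_powr 0 r y = y powr r"
| "diff_powr (Suc n) r y = diff_powr n r (y + 1) - diff_powr n r y"

text \<open>Differentiation commutes with shifts, so it passes through the forward differences and
  only lowers the exponent.\<close>

lemma diff_powr_has_real_derivative:
  assumes "y > 0"
  shows "(diff_powr n r has_real_derivative r * diff_powr n (r - 1) y) (at y)"
  using assms
proof (induction n arbitrary: y)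
  case 0
  have "((\<lambda>y. y powr r) has_real_derivative r * y powr (r - 1)) (at y)"
    by (rule has_real_derivative_powr[OF 0])
  moreover have "diff_powr 0 r = (\<lambda>y. y powr r)" by (rule ext) simp
  ultimately show ?case by simp
next
  case (Suc n)
  have a: "((\<lambda>y. diff_powr n r (y + 1)) has_real_derivative r * diff_powr n (r - 1) (y + 1)) (at y)"
    using DERIV_shift[of "diff_powr n r" _ y 1] Suc.IH[of "y + 1"] Suc.prems by (simp add: add.commute)
  have "((\<lambda>y. diff_powr n r (y + 1) - diff_powr n r y) has_real_derivative
      r * diff_powr n (r - 1) (y + 1) - r * diff_powr n (r - 1) y) (at y)"
    by (rule DERIV_diff[OF a Suc.IH[OF Suc.prems]])
  moreover have "diff_powr (Suc n) r = (\<lambda>y. diff_powr n r (y + 1) - diff_powr n r y)"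
    by (rule ext) simp
  ultimately show ?case by (simp add: right_diff_distrib)
qed

lemma diff_powr_continuous:
  assumes "r > 0"
  shows "continuous_on {0..} (diff_powr n r)"
proof (induction n)
  case 0
  have "diff_powr 0 r = (\<lambda>y. y powr r)" by (rule ext) simp
  moreover have "continuous_on {0..} (\<lambda>y::real. y powr r)"
    using assms by (intro continuous_on_powr' continuous_intros) auto
  ultimately show ?case by simp
next
  case (Suc n)
  have "diff_powr (Suc n) r = (\<lambda>y. diff_powr n r (y + 1) - diff_powr n r y)"
    by (rule ext) simp
  moreover have "continuous_on {0..} (\<lambda>y. diff_powr n r (y + 1))"
    by (rule continuous_on_compose2[OF Suc]) (auto intro!: continuous_intros)
  ultimately show ?case using Suc by (simp add: continuous_on_diff)
qed

text \<open>The mean value theorem trades one difference for one derivative. The start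
  \<open>y = 0\<close> is allowed for positive exponents, by continuity up to \<open>0\<close>; the
  new point \<open>\<xi>\<close> is strictly positive, so from then on the exponent may become
  negative.\<close>

lemma diff_powr_Suc_mvt:
  assumes "0 < y \<or> (y = 0 \<and> r > 0)"
  obtains \<xi> where "\<xi> > 0" "diff_powr (Suc n) r y = r * diff_powr n (r - 1) \<xi>"
proof -
  have c: "continuous_on {y..y+1} (diff_powr n r)"
  proof (cases "y = 0")
    case True
    then show ?thesis using assms diff_powr_continuous[of r n]
      by (auto intro: continuous_on_subset)
  next
    case False
    then show ?thesis
      using assms by (intro DERIV_continuous_on[where D = "\<lambda>y. r * diff_powr n (r - 1) y"])
        (auto intro!: has_field_derivative_at_within[OF diff_powr_has_real_derivative])
  qed
  have "\<exists>l z. y < z \<and> z < y + 1 \<and> DERIV (diff_powr n r) z :> l \<and>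
      diff_powr n r (y + 1) - diff_powr n r y = (y + 1 - y) * l"
    using assms diff_powr_has_real_derivative
    by (intro MVT c) (auto simp: real_differentiable_def, metis less_trans)
  then obtain l z where z: "y < z" "DERIV (diff_powr n r) z :> l"
      "diff_powr n r (y + 1) - diff_powr n r y = l" by auto
  have "l = r * diff_powr n (r - 1) z"
    using z assms by (intro DERIV_unique[OF z(2)] diff_powr_has_real_derivative) auto
  with z assms that[of z] show thesis by auto
qed

text \<open>A difference of order \<open>n\<close> has the sign of the derivative of order
  \<open>n\<close>, that is of \<open>r (r - 1) ... (r - n + 1)\<close>. The multiplier
  \<open>\<sigma>\<close> collects the factors split off in the induction and treats both signs at
  once.\<close>

lemma diff_powr_sign:
  assumes "0 < y \<or> (y = 0 \<and> r > 0)" "\<sigma> * (\<Prod>i<n. r - real i) \<ge> 0"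
  shows "\<sigma> * diff_powr n r y \<ge> 0"
  using assms
proof (induction n arbitrary: \<sigma> r y)
  case 0
  then show ?case by simp
next
  case (Suc n)
  obtain \<xi> where \<xi>: "\<xi> > 0" "diff_powr (Suc n) r y = r * diff_powr n (r - 1) \<xi>"
    using diff_powr_Suc_mvt[OF Suc.prems(1)] by metis
  have "(\<Prod>i<Suc n. r - real i) = r * (\<Prod>i<n. r - 1 - real i)"
    by (subst prod.lessThan_Suc_shift) (simp add: algebra_simps)
  then have "\<sigma> * r * (\<Prod>i<n. r - 1 - real i) \<ge> 0"
    using Suc.prems(2) by (simp add: mult.assoc)
  then have "\<sigma> * r * diff_powr n (r - 1) \<xi> \<ge> 0"
    using \<xi>(1) by (intro Suc.IH) auto
  then show ?case using \<xi>(2) by (simp add: mult.assoc)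
qed

text \<open>\<open>coeff_G\<close> is itself a second difference, so orders 2, 3 and 4 give its
  sign, its monotonicity and its convexity. The point \<open>y = 0\<close> is included because it
  corresponds to \<open>coeff_G \<alpha> 1\<close>.\<close>

lemma diff_powr_signs:
  assumes "0 < \<alpha>" "\<alpha> < 1" "y \<ge> 0"
  shows "diff_powr 2 (2 - \<alpha>) y \<ge> 0" "diff_powr 3 (2 - \<alpha>) y \<le> 0" "diff_powr 4 (2 - \<alpha>) y \<ge> 0"
proof -
  have y: "0 < y \<or> (y = 0 \<and> 2 - \<alpha> > 0)" using assms by auto
  have p: "(2 - \<alpha>) * (1 - \<alpha>) \<ge> 0" using assms by simp
  have "0 \<le> 1 * (\<Prod>i<2. 2 - \<alpha> - real i)"
    using p by (simp add: numeral_eq_Suc algebra_simps)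
  from diff_powr_sign[OF y this] show "diff_powr 2 (2 - \<alpha>) y \<ge> 0" by simp
  have "0 \<le> (2 - \<alpha>) * (1 - \<alpha>) * \<alpha>" using p assms by simp
  then have "0 \<le> -1 * (\<Prod>i<3. 2 - \<alpha> - real i)" by (simp add: numeral_eq_Suc algebra_simps)
  from diff_powr_sign[OF y this] show "diff_powr 3 (2 - \<alpha>) y \<le> 0" by simp
  have "0 \<le> (2 - \<alpha>) * (1 - \<alpha>) * (\<alpha> * (1 + \<alpha>))" using p assms by simp
  then have "0 \<le> 1 * (\<Prod>i<4. 2 - \<alpha> - real i)" by (simp add: numeral_eq_Suc algebra_simps)
  from diff_powr_sign[OF y this] show "diff_powr 4 (2 - \<alpha>) y \<ge> 0" by simp
qed

lemma coeff_G_diff_powr: "coeff_G \<alpha> (Suc m) = diff_powr 2 (2 - \<alpha>) (real m)"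
  by (simp add: coeff_G_def coeff_M_def numeral_2_eq_2 algebra_simps)

lemma coeff_G_nonneg:
  assumes "0 < \<alpha>" "\<alpha> < 1"
  shows "coeff_G \<alpha> (Suc m) \<ge> 0"
  using diff_powr_signs(1)[OF assms, of "real m"] by (simp only: coeff_G_diff_powr of_nat_0_le_iff)

lemma coeff_G_decreasing:
  assumes "0 < \<alpha>" "\<alpha> < 1"
  shows "coeff_G \<alpha> (Suc (Suc m)) \<le> coeff_G \<alpha> (Suc m)"
proof -
  have "diff_powr 3 (2 - \<alpha>) (real m) = coeff_G \<alpha> (Suc (Suc m)) - coeff_G \<alpha> (Suc m)"
    unfolding coeff_G_diff_powr by (simp add: numeral_eq_Suc algebra_simps)
  with diff_powr_signs(2)[OF assms, of "real m"] show ?thesis by simp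
qed

lemma coeff_G_convex:
  assumes "0 < \<alpha>" "\<alpha> < 1"
  shows "coeff_G \<alpha> (Suc (Suc m)) - coeff_G \<alpha> (Suc (Suc (Suc m)))
    \<le> coeff_G \<alpha> (Suc m) - coeff_G \<alpha> (Suc (Suc m))"
proof -
  have "diff_powr 4 (2 - \<alpha>) (real m) =
      coeff_G \<alpha> (Suc (Suc (Suc m))) - 2 * coeff_G \<alpha> (Suc (Suc m)) + coeff_G \<alpha> (Suc m)"
    unfolding coeff_G_diff_powr by (simp add: numeral_eq_Suc algebra_simps)
  with diff_powr_signs(3)[OF assms, of "real m"] show ?thesis by simp
qed

text \<open>Weighted AM--GM for \<open>1\<close> and \<open>3 powr (-\<alpha>)\<close>, together with \<open>3 ^ 9 \<le> 2 ^ 16\<close>.\<close>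

lemma coeff_G_1_2:
  assumes "0 < \<alpha>" "\<alpha> < 1"
  shows "coeff_G \<alpha> 1 - coeff_G \<alpha> 2 / 2 \<le> 1"
proof -
  have conv: "convex_on UNIV (\<lambda>y::real. exp y)" by (rule exp_convex)
  have "exp ((1 - 9/16) *\<^sub>R 0 + (9/16) *\<^sub>R (- \<alpha> * ln 3)) \<le> (1 - 9/16) * exp 0 + 9/16 * exp (- \<alpha> * ln 3)"
    by (rule convex_onD[OF conv]) auto
  then have 1: "exp (- \<alpha> * (9/16 * ln 3)) \<le> 7/16 + 9/16 * 3 powr (-\<alpha>)"
    by (simp add: powr_def algebra_simps)
  have "ln ((3::real) ^ 9) \<le> ln (2 ^ 16)" by (subst ln_le_cancel_iff) auto
  then have "9 * ln 3 \<le> 16 * ln (2::real)" by (subst (asm) (1 2) ln_realpow) auto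
  then have "9/16 * ln 3 \<le> ln (2::real)" by simp
  then have "exp (- \<alpha> * ln 2) \<le> exp (- \<alpha> * (9/16 * ln 3))" using assms by simp
  moreover have "exp (- \<alpha> * ln 2) = 2 powr (-\<alpha>)" by (simp add: powr_def)
  ultimately have 2: "16 * 2 powr (-\<alpha>) \<le> 7 + 9 * (3::real) powr (-\<alpha>)" using 1 by linarith
  have e: "(2::real) powr (2 - \<alpha>) = 4 * 2 powr (-\<alpha>)" "(3::real) powr (2 - \<alpha>) = 9 * 3 powr (-\<alpha>)"
    using powr_add[of "2::real" 2 "-\<alpha>"] powr_add[of "3::real" 2 "-\<alpha>"] by simp_all
  show ?thesis using 2 by (simp add: coeff_G_def coeff_M_def e field_simps)
qed

section \<open>Stability\<close>

text \<open>All indices \<open>q \<le> p\<close> fall on \<open>c 0\<close>, which vanishes; what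
  remains is an initial segment of the sum on the right.\<close>

lemma sum_shift_le:
  fixes c :: "nat \<Rightarrow> real"
  assumes "c 0 = 0" "\<And>q. c q \<ge> 0"
  shows "(\<Sum>q=1..K. c (q - p)) \<le> (\<Sum>q=1..K. c q)"
proof -
  have "(\<Sum>q=1..K. c (q - p)) = (\<Sum>q=1..K - p. c q)"
  proof (induction K)
    case (Suc K)
    then show ?case using assms(1) by (cases "p \<le> K") (auto simp: Suc_diff_le not_le)
  qed simp
  also have "\<dots> \<le> (\<Sum>q=1..K. c q)"
    using assms(2) by (intro sum_mono2) auto
  finally show ?thesis .
qed

text \<open>
  Throughout, \<open>e 0 = 0\<close>, so the truncated subtraction on indices extends \<open>e\<close> by zero to negative times.
\<close>

definition lag_form :: "(nat \<Rightarrow> real) \<Rightarrow> nat \<Rightarrow> nat \<Rightarrow> real" where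
  "lag_form e K m = (\<Sum>q=1..K. (e q + e (q - 1)) * (e q - e (q - Suc m)))"

lemma sum_telescope_squares:
  fixes e :: "nat \<Rightarrow> real"
  assumes "e 0 = 0"
  shows "(\<Sum>q=1..K. (e q)\<^sup>2 - (e (q - 1))\<^sup>2) = (e K)\<^sup>2"
  using assms by (induction K) auto

text \<open>
  A single lag has no sign. Two consecutive lags add up to a form in \<open>b q = e q + e (q - 1)\<close>
  that is nonnegative by the Cauchy--Schwarz inequality, plus a telescoping square.
\<close>

lemma lag_form_pair:
  assumes e0: "e 0 = 0"
  shows "(e K)\<^sup>2 \<le> lag_form e K (Suc n) + lag_form e K (Suc (Suc n))"
proof -
  define b where "b q = e q + e (q - 1)" for q
  have "lag_form e K (Suc n) + lag_form e K (Suc (Suc n))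
      = (\<Sum>q=1..K. b q * (2 * e q - b (q - Suc (Suc n))))"
    unfolding lag_form_def b_def by (simp add: sum.distrib[symmetric] algebra_simps)
  \<comment> \<open>Split \<open>2 * e q\<close> into \<open>b q\<close> and
    \<open>e q - e (q - 1)\<close>; the second part times \<open>b q\<close> is a difference of
    squares.\<close>
  also have "\<dots> = (\<Sum>q=1..K. ((b q)\<^sup>2 - b q * b (q - Suc (Suc n))) + ((e q)\<^sup>2 - (e (q - 1))\<^sup>2))"
    by (intro sum.cong) (auto simp: b_def power2_eq_square algebra_simps)
  also have "\<dots> = (\<Sum>q=1..K. (b q)\<^sup>2 - b q * b (q - Suc (Suc n))) + (e K)\<^sup>2"
    using sum_telescope_squares[of e K, OF e0] by (simp only: sum.distrib)
  finally have eq: "lag_form e K (Suc n) + lag_form e K (Suc (Suc n))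
      = (\<Sum>q=1..K. (b q)\<^sup>2 - b q * b (q - Suc (Suc n))) + (e K)\<^sup>2" .
  have "(\<Sum>q=1..K. 2 * (b q * b (q - Suc (Suc n)))) \<le> (\<Sum>q=1..K. (b q)\<^sup>2 + (b (q - Suc (Suc n)))\<^sup>2)"
    by (intro sum_mono) (use sum_squares_bound in \<open>auto simp: mult.assoc\<close>)
  also have "\<dots> \<le> (\<Sum>q=1..K. (b q)\<^sup>2) + (\<Sum>q=1..K. (b q)\<^sup>2)"
    using sum_shift_le[where c = "\<lambda>q. (b q)\<^sup>2" and K = K and p = "Suc (Suc n)"] e0 by (simp add: sum.distrib b_def)
  finally show ?thesis
    unfolding eq by (simp add: sum_subtractf sum_distrib_left[symmetric])
qed

text \<open>Lags are paired from the top downwards. For even \<open>n\<close> the pairs exhaust all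
  lags; for odd \<open>n\<close> the lag 1 is left over, and it is nonnegative by itself since
  \<open>e q - e (q - 2)\<close> equals \<open>b q - b (q - 1)\<close>. Each pair contributes one
  square, hence \<open>n div 2\<close>.\<close>

lemma lag_form_sum:
  assumes e0: "e 0 = 0"
  shows "real (n div 2) * (e K)\<^sup>2 \<le> (\<Sum>m=1..n. lag_form e K m)"
proof (induction n rule: nat_less_induct)
  case (1 n)
  consider "n = 0" | "n = 1" | k where "n = Suc (Suc k)"
    by (metis One_nat_def not0_implies_Suc)
  then show ?case
  proof cases
    case 2
    define b where "b q = e q + e (q - 1)" for q
    have "lag_form e K 1 = (\<Sum>q=1..K. (b q)\<^sup>2 - b q * b (q - 1))"
      unfolding lag_form_def b_def 
      by (intro sum.cong) (auto simp: power2_eq_square algebra_simps)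
    moreover have "(\<Sum>q=1..K. 2 * (b q * b (q - 1))) \<le> (\<Sum>q=1..K. (b q)\<^sup>2 + (b (q - 1))\<^sup>2)"
      by (intro sum_mono) (use sum_squares_bound in \<open>auto simp: mult.assoc\<close>)
    moreover have "\<dots> \<le> (\<Sum>q=1..K. (b q)\<^sup>2) + (\<Sum>q=1..K. (b q)\<^sup>2)"
      using sum_shift_le[where c = "\<lambda>q. (b q)\<^sup>2" and K = K and p = 1] e0 by (simp add: sum.distrib b_def)
    ultimately show ?thesis 
      using 2 by (simp add: sum_subtractf sum_distrib_left[symmetric])
  next
    case 3
    then have "real (k div 2) * (e K)\<^sup>2 \<le> (\<Sum>m=1..k. lag_form e K m)"
      using "1.IH" by simp
    then show ?thesis
      using lag_form_pair[where e = e and K = K and n = k, OF e0] 3 by (simp add: algebra_simps)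
  qed simp
qed

text \<open>Abel summation: the difference of the two sides is a combination of the nonnegative
  partial sums \<open>z\<close>, with the decrements of \<open>d\<close> and one final value of
  \<open>d\<close> as coefficients. The induction keeps the boundary term
  \<open>d (Suc n) * z n\<close>, which absorbs each decrement.\<close>

lemma abel_mono:
  fixes d x y :: "nat \<Rightarrow> real"
  assumes "\<And>n. (\<Sum>m=1..n. y m) \<le> (\<Sum>m=1..n. x m)"
    and "\<And>m. d (Suc m) \<ge> 0" "\<And>m. d (Suc (Suc m)) \<le> d (Suc m)"
  shows "(\<Sum>m=1..n. d m * y m) \<le> (\<Sum>m=1..n. d m * x m)"
proof -
  define z where "z n = (\<Sum>m=1..n. x m - y m)" for n
  have z: "z n \<ge> 0" for n using assms(1)[of n] by (simp add: z_def sum_subtractf)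
  have "d (Suc n) * z n \<le> (\<Sum>m=1..n. d m * (x m - y m))" for n
  proof (induction n)
    case (Suc n)
    have "d (Suc (Suc n)) * z (Suc n) \<le> d (Suc n) * z (Suc n)"
      using assms(3) z by (intro mult_right_mono)
    also have "\<dots> = d (Suc n) * z n + d (Suc n) * (x (Suc n) - y (Suc n))"
      by (simp add: z_def algebra_simps)
    finally show ?case using Suc by simp
  qed (simp add: z_def)
  from this[of n] have "0 \<le> (\<Sum>m=1..n. d m * (x m - y m))"
    using mult_nonneg_nonneg[OF assms(2)[of n] z[of n]] by linarith
  then show ?thesis by (simp add: right_diff_distrib sum_subtractf)
qed

lemma sum_by_parts:
  fixes G c :: "nat \<Rightarrow> real"
  shows "(\<Sum>m=1..n. G m * (c (m - 1) - c m))
    = (\<Sum>m=1..n. (G m - G (Suc m)) * (c 0 - c m)) + G (Suc n) * (c 0 - c n)"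
  by (induction n) (auto simp: algebra_simps)

text \<open>The sum over lags is extended from \<open>k\<close> to a common bound \<open>K\<close>,
  so that the sums over time and over lags can be exchanged later. For \<open>m > k\<close> the
  value \<open>e (k - m)\<close> is \<open>e 0 = 0\<close>, and each added term is compensated by
  the change of the coefficient of \<open>e k\<close> in the tail.\<close>

lemma memory_sum_by_parts:
  fixes G e :: "nat \<Rightarrow> real"
  assumes e0: "e 0 = 0" and "k \<le> K"
  shows "(\<Sum>j<k. G (k - j) * (e (Suc j) - e j))
    = (\<Sum>m=1..K. (G m - G (Suc m)) * (e k - e (k - m))) + G (Suc K) * e k"
  using \<open>k \<le> K\<close>
proof (induction K rule: dec_induct)
  case base
  have "(\<Sum>j<k. G (k - j) * (e (Suc j) - e j)) = (\<Sum>m=1..k. G m * (e (k - (m - 1)) - e (k - m)))"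
    by (rule sum.reindex_bij_witness[of _ "\<lambda>m. k - m" "\<lambda>m. k - m"]) (auto simp: Suc_diff_le)
  then show ?case
    using sum_by_parts[of G "\<lambda>m. e (k - m)" k] e0 by simp
next
  case (step K)
  then show ?case using e0 by (simp add: algebra_simps)
qed

text \<open>
  The quadratic form is truncated at time \<open>K\<close>, so it is not a positive one; the defect is a multiple of
  \<open>e\<^sub>K\<^sup>2\<close> that the local term of the scheme can absorb.
\<close>

lemma memory_form_bound:
  fixes G e :: "nat \<Rightarrow> real"
  assumes e0: "e 0 = 0"
    and G0: "\<And>m. G (Suc m) \<ge> 0"
    and G1: "\<And>m. G (Suc (Suc m)) \<le> G (Suc m)"
    and G2: "\<And>m. G (Suc (Suc m)) - G (Suc (Suc (Suc m))) \<le> G (Suc m) - G (Suc (Suc m))"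
  shows "- (G 1 - G 2 / 2) * (e K)\<^sup>2
    \<le> (\<Sum>k<K. (e (Suc k) + e k) * (\<Sum>j<k. G (k - j) * (e (Suc j) - e j)))"
proof -
  define d where "d m = G m - G (Suc m)" for m
  define E where "E = (e K)\<^sup>2"
  \<comment> \<open>For \<open>n \<ge> 1\<close> the partial sums are
    \<open>(n - 1) / 2 * E\<close>, which lies below \<open>real (n div 2) * E\<close> for both
    parities. Being constant from lag 2 on, \<open>y\<close> sums against \<open>d\<close> by
    telescoping; this is where \<open>G 2 / 2\<close> comes from.\<close>
  define y where "y m = (if m = 1 then 0 else E / 2)" for m :: nat
  have d_sum: "(\<Sum>m=1..n. d m) = G 1 - G (Suc n)" for n
    by (induction n) (auto simp: d_def)
  have y_sum: "(\<Sum>m=1..n. y m) \<le> real (n div 2) * E" for n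
  proof (cases n)
    case (Suc k)
    have "(\<Sum>m=1..Suc k. y m) = real k * (E / 2)"
      by (induction k) (auto simp: y_def algebra_simps)
    moreover have "real k / 2 \<le> real (n div 2)" using Suc by linarith
    ultimately show ?thesis
      using mult_right_mono[of "real k / 2" "real (n div 2)" E] Suc by (simp add: E_def del: sum.cl_ivl_Suc)
  qed simp
  \<comment> \<open>The second summation by parts: \<open>d\<close> is nonnegative because
    \<open>G\<close> decreases, and decreasing because \<open>G\<close> is convex.\<close>
  have Q: "(\<Sum>m=1..K. d m * y m) \<le> (\<Sum>m=1..K. d m * lag_form e K m)"
    using G1 G2 lag_form_sum[where e = e, OF e0] y_sum
    by (intro abel_mono order_trans[OF y_sum]) (auto simp: d_def E_def)
  have dy: "(G 2 - G (Suc K)) / 2 * E \<le> (\<Sum>m=1..K. d m * y m)"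
  proof (cases K)
    case 0
    then show ?thesis using G1[of 0] e0 by (simp add: E_def)
  next
    case (Suc k)
    have "(\<Sum>m=1..Suc k. d m * y m) = (G 2 - G (Suc (Suc k))) / 2 * E" for k
      by (induction k) (auto simp: y_def d_def algebra_simps numeral_2_eq_2)
    then show ?thesis using Suc by simp
  qed
  have tele: "(\<Sum>k<K. (e (Suc k))\<^sup>2 - (e k)\<^sup>2) = E"
    by (simp add: sum_lessThan_telescope[of "\<lambda>k. (e k)\<^sup>2"] E_def e0)
  \<comment> \<open>The memory sum compares past values with \<open>e k\<close>, the lag forms with
    \<open>e (Suc k)\<close>. The change costs one telescoping \<open>E\<close> per lag; weighted by
    \<open>d\<close>, these add up to \<open>(G 1 - G (Suc K)) * E\<close>.\<close>
  have lag: "lag_form e K m = (\<Sum>k<K. (e (Suc k) + e k) * (e k - e (k - m))) + E" for m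
  proof -
    have "lag_form e K m = (\<Sum>k<K. (e (Suc k) + e k) * (e (Suc k) - e (k - m)))"
      unfolding lag_form_def 
      by (rule sum.reindex_bij_witness[of _ "Suc" "\<lambda>q. q - 1"]) auto
    also have "\<dots> = (\<Sum>k<K. (e (Suc k) + e k) * (e k - e (k - m)) + ((e (Suc k))\<^sup>2 - (e k)\<^sup>2))"
      by (intro sum.cong) (auto simp: algebra_simps power2_eq_square)
    also have "\<dots> = (\<Sum>k<K. (e (Suc k) + e k) * (e k - e (k - m))) + E"
      by (simp only: sum.distrib tele)
    finally show ?thesis .
  qed
  have tail: "- E / 2 \<le> (\<Sum>k<K. (e (Suc k) + e k) * e k)"
  proof -
    have "(\<Sum>k<K. (e (Suc k) + e k) * e k)
        = (\<Sum>k<K. (e (Suc k) + e k)\<^sup>2 / 2 - ((e (Suc k))\<^sup>2 - (e k)\<^sup>2) / 2)"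
      by (intro sum.cong) (auto simp: field_simps power2_eq_square)
    also have "\<dots> = (\<Sum>k<K. (e (Suc k) + e k)\<^sup>2 / 2) - E / 2"
      by (subst sum_subtractf) (simp only: sum_divide_distrib[symmetric] tele)
    finally show ?thesis by (simp add: sum_nonneg)
  qed
  have mem: "(\<Sum>j<k. G (k - j) * (e (Suc j) - e j))
      = (\<Sum>m=1..K. d m * (e k - e (k - m))) + G (Suc K) * e k" if "k < K" for k
    unfolding d_def using that by (intro memory_sum_by_parts[where e = e, OF e0]) auto
  have alg: "b * ((\<Sum>m=1..K. d m * c m) + g * x) = (\<Sum>m=1..K. d m * (b * c m)) + g * (b * x)" for b c g x
    by (simp add: distrib_left sum_distrib_left mult_ac)
  have "(\<Sum>k<K. (e (Suc k) + e k) * (\<Sum>j<k. G (k - j) * (e (Suc j) - e j)))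
      = (\<Sum>k<K. (\<Sum>m=1..K. d m * ((e (Suc k) + e k) * (e k - e (k - m))))
          + G (Suc K) * ((e (Suc k) + e k) * e k))"
    using mem by (intro sum.cong) (simp_all only: alg lessThan_iff)
  also have "\<dots> = (\<Sum>m=1..K. d m * (\<Sum>k<K. (e (Suc k) + e k) * (e k - e (k - m))))
      + G (Suc K) * (\<Sum>k<K. (e (Suc k) + e k) * e k)"
    unfolding sum.distrib sum_distrib_left by (subst sum.swap) simp
  also have "(\<Sum>m=1..K. d m * (\<Sum>k<K. (e (Suc k) + e k) * (e k - e (k - m))))
      = (\<Sum>m=1..K. d m * lag_form e K m) - (G 1 - G (Suc K)) * E"
    unfolding lag d_sum[symmetric] sum_distrib_right
    by (simp add: sum.distrib[symmetric] sum_subtractf[symmetric] algebra_simps)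
  finally have eq: "(\<Sum>k<K. (e (Suc k) + e k) * (\<Sum>j<k. G (k - j) * (e (Suc j) - e j)))
      = (\<Sum>m=1..K. d m * lag_form e K m) - (G 1 - G (Suc K)) * E
        + G (Suc K) * (\<Sum>k<K. (e (Suc k) + e k) * e k)" .
  have "G (Suc K) * (- E / 2) \<le> G (Suc K) * (\<Sum>k<K. (e (Suc k) + e k) * e k)"
    by (rule mult_left_mono[OF tail G0])
  \<comment> \<open>\<open>G (Suc K) * E\<close> occurs with the factors -1/2 from
    \<open>dy\<close>, 1 from the change of lag forms and -1/2 from the tail, and so drops out: the
    defect does not depend on \<open>K\<close>.\<close>
  then show ?thesis
    unfolding eq E_def[symmetric] using Q dy by (simp add: algebra_simps)
qed

text \<open>Summation by parts produces minus a sum of squared differences; since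
  \<open>w M = 0\<close>, the boundary term at the right end is minus a square as well.\<close>

lemma discrete_laplacian_nonpos:
  fixes w :: "nat \<Rightarrow> real"
  assumes "w 0 = 0" "w M = 0"
  shows "(\<Sum>i=1..M-1. w i * (w (i + 1) - 2 * w i + w (i - 1))) \<le> 0"
proof -
  have "(\<Sum>i=1..n. w i * (w (i + 1) - 2 * w i + w (i - 1)))
      = w n * (w (Suc n) - w n) - (\<Sum>i=1..n. (w i - w (i - 1))\<^sup>2)" for n
    using assms(1) by (induction n) (auto simp: algebra_simps power2_eq_square)
  from this[of "M - 1"] have "(\<Sum>i=1..M-1. w i * (w (i + 1) - 2 * w i + w (i - 1)))
      = - (w (M - 1) * w (M - 1)) - (\<Sum>i=1..M-1. (w i - w (i - 1))\<^sup>2)"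
    using assms by (cases M) auto
  moreover have "0 \<le> (\<Sum>i=1..M-1. (w i - w (i - 1))\<^sup>2)" by (intro sum_nonneg) auto
  ultimately show ?thesis using zero_le_square[of "w (M - 1)"] by linarith
qed

text \<open>The energy method for an arbitrary right-hand side \<open>R\<close>. The factor 2 is
  independent of \<open>\<beta>\<close>, \<open>\<kappa>\<close> and \<open>N\<close>, so only the
  sum of the bounds \<open>\<rho>\<close> over time matters, and single steps may be less accurate
  than average.\<close>

lemma crank_nicolson_stability:
  fixes e R :: "nat \<Rightarrow> nat \<Rightarrow> real" and G \<rho> :: "nat \<Rightarrow> real"
  assumes "\<beta> \<ge> 0" "\<kappa> \<ge> 0"
    and G0: "\<And>m. G (Suc m) \<ge> 0"
    and G1: "\<And>m. G (Suc (Suc m)) \<le> G (Suc m)"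
    and G2: "\<And>m. G (Suc (Suc m)) - G (Suc (Suc (Suc m))) \<le> G (Suc m) - G (Suc (Suc m))"
    and G12: "G 1 - G 2 / 2 \<le> 1"
    and eq: "\<And>i k. i \<in> {1..M-1} \<Longrightarrow> k < N \<Longrightarrow>
      (1 + \<beta>) * (e i (Suc k) - e i k) + \<beta> * (\<Sum>j<k. G (k - j) * (e i (Suc j) - e i j))
      - \<kappa> * ((e (i + 1) (Suc k) + e (i + 1) k) - 2 * (e i (Suc k) + e i k)
          + (e (i - 1) (Suc k) + e (i - 1) k)) = R i k"
    and bd: "\<And>k. k \<le> N \<Longrightarrow> e 0 k = 0" "\<And>k. k \<le> N \<Longrightarrow> e M k = 0"
    and init: "\<And>i. i \<in> {1..M-1} \<Longrightarrow> e i 0 = 0"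
    and \<rho>: "\<And>k. k < N \<Longrightarrow> L2_set (\<lambda>i. R i k) {1..M-1} \<le> \<rho> k"
    and "k \<le> N"
  shows "L2_set (\<lambda>i. e i k) {1..M-1} \<le> 2 * (\<Sum>k<N. \<rho> k)"
proof -
  define A where "A = {1..M-1}"
  define n where "n k = L2_set (\<lambda>i. e i k) A" for k
  define w where "w i k = e i (Suc k) + e i k" for i k
  define S where "S i k = (\<Sum>j<k. G (k - j) * (e i (Suc j) - e i j))" for i k
  have n_nonneg: "n k \<ge> 0" for k by (simp add: n_def)
  have \<rho>_nonneg: "0 \<le> \<rho> k" if "k < N" for k
    using \<rho>[OF that] L2_set_nonneg order_trans by blast
  have step: "(\<Sum>i\<in>A. (1 + \<beta>) * ((e i (Suc k))\<^sup>2 - (e i k)\<^sup>2) + \<beta> * (w i k * S i k))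
      \<le> \<rho> k * (n (Suc k) + n k)" if "k < N" for k
  proof -
    have "(\<Sum>i\<in>A. (1 + \<beta>) * ((e i (Suc k))\<^sup>2 - (e i k)\<^sup>2) + \<beta> * (w i k * S i k))
        = (\<Sum>i\<in>A. \<kappa> * (w i k * (w (i + 1) k - 2 * w i k + w (i - 1) k)) + w i k * R i k)"
    proof (intro sum.cong refl)
      fix i assume "i \<in> A"
      then have "w i k * R i k = w i k * ((1 + \<beta>) * (e i (Suc k) - e i k) + \<beta> * S i k
          - \<kappa> * (w (i + 1) k - 2 * w i k + w (i - 1) k))"
        using eq[of i k] that by (simp add: A_def w_def S_def)
      then show "(1 + \<beta>) * ((e i (Suc k))\<^sup>2 - (e i k)\<^sup>2) + \<beta> * (w i k * S i k)
        = \<kappa> * (w i k * (w (i + 1) k - 2 * w i k + w (i - 1) k)) + w i k * R i k"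
        by (simp add: w_def algebra_simps power2_eq_square)
    qed
    also have "\<dots> = \<kappa> * (\<Sum>i\<in>A. w i k * (w (i + 1) k - 2 * w i k + w (i - 1) k)) + (\<Sum>i\<in>A. w i k * R i k)"
      by (simp only: sum.distrib sum_distrib_left)
    also have "\<dots> \<le> (\<Sum>i\<in>A. w i k * R i k)"
    proof -
      have "(\<Sum>i\<in>A. w i k * (w (i + 1) k - 2 * w i k + w (i - 1) k)) \<le> 0"
        unfolding A_def using that bd by (intro discrete_laplacian_nonpos) (auto simp: w_def)
      then show ?thesis using \<open>\<kappa> \<ge> 0\<close> by (simp add: mult_nonneg_nonpos)
    qed
    also have "\<dots> \<le> (\<Sum>i\<in>A. \<bar>R i k\<bar> * \<bar>w i k\<bar>)"
      by (intro sum_mono) (metis abs_ge_self abs_mult mult.commute)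
    also have "\<dots> \<le> L2_set (\<lambda>i. R i k) A * L2_set (\<lambda>i. w i k) A"
      by (rule L2_set_mult_ineq)
    also have "\<dots> \<le> \<rho> k * (n (Suc k) + n k)"
      unfolding w_def n_def using \<rho>[OF that] \<rho>_nonneg[OF that]
      by (intro mult_mono L2_set_triangle_ineq) (auto simp: A_def)
    finally show ?thesis .
  qed
  have energy: "(n K)\<^sup>2 \<le> (\<Sum>k<K. \<rho> k * (n (Suc k) + n k))" if "K \<le> N" for K
  proof -
    have "(n K)\<^sup>2 = (\<Sum>i\<in>A. (e i K)\<^sup>2)"
      by (simp add: n_def L2_set_def sum_nonneg)
    also have "\<dots> \<le> (\<Sum>i\<in>A. (1 + \<beta>) * (e i K)\<^sup>2 + \<beta> * (\<Sum>k<K. w i k * S i k))"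
    proof (rule sum_mono)
      fix i assume "i \<in> A"
      then have e0: "e i 0 = 0" using init by (simp add: A_def)
      have "- 1 * (e i K)\<^sup>2 \<le> - (G 1 - G 2 / 2) * (e i K)\<^sup>2"
        using G12 by (intro mult_right_mono) auto
      also have "\<dots> \<le> (\<Sum>k<K. w i k * S i k)"
        unfolding w_def S_def by (rule memory_form_bound[where e = "e i" and G = G, OF e0 G0 G1 G2])
      finally have "\<beta> * (- 1 * (e i K)\<^sup>2) \<le> \<beta> * (\<Sum>k<K. w i k * S i k)"
        using \<open>\<beta> \<ge> 0\<close> by (rule mult_left_mono)
      then show "(e i K)\<^sup>2 \<le> (1 + \<beta>) * (e i K)\<^sup>2 + \<beta> * (\<Sum>k<K. w i k * S i k)"
        by (simp add: algebra_simps)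
    qed
    also have "\<dots> = (\<Sum>i\<in>A. \<Sum>k<K. (1 + \<beta>) * ((e i (Suc k))\<^sup>2 - (e i k)\<^sup>2) + \<beta> * (w i k * S i k))"
    proof (intro sum.cong refl)
      fix i assume "i \<in> A"
      then have e0: "e i 0 = 0" using init by (simp add: A_def)
      have "(\<Sum>k<K. (e i (Suc k))\<^sup>2 - (e i k)\<^sup>2) = (e i K)\<^sup>2"
        using e0 by (simp add: sum_lessThan_telescope[of "\<lambda>k. (e i k)\<^sup>2"])
      then show "(1 + \<beta>) * (e i K)\<^sup>2 + \<beta> * (\<Sum>k<K. w i k * S i k)
        = (\<Sum>k<K. (1 + \<beta>) * ((e i (Suc k))\<^sup>2 - (e i k)\<^sup>2) + \<beta> * (w i k * S i k))"
        by (simp only: sum.distrib sum_distrib_left[symmetric])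
    qed
    also have "\<dots> = (\<Sum>k<K. \<Sum>i\<in>A. (1 + \<beta>) * ((e i (Suc k))\<^sup>2 - (e i k)\<^sup>2) + \<beta> * (w i k * S i k))"
      by (rule sum.swap)
    also have "\<dots> \<le> (\<Sum>k<K. \<rho> k * (n (Suc k) + n k))"
      using that by (intro sum_mono step) auto
    finally show ?thesis .
  qed
  \<comment> \<open>At the time where the norm is largest, every norm on the right of the energy
    bound is at most \<open>E\<close>, so one factor \<open>E\<close> cancels.\<close>
  define E where "E = Max (n ` {..N})"
  have nE: "n k \<le> E" if "k \<le> N" for k using that by (auto simp: E_def)
  have "E \<in> n ` {..N}" unfolding E_def by (intro Max_in) auto
  then obtain K where K: "K \<le> N" "E = n K" by auto
  have "E\<^sup>2 \<le> (\<Sum>k<K. \<rho> k * (n (Suc k) + n k))" using energy[OF K(1)] K(2) by simp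
  also have "\<dots> \<le> (\<Sum>k<K. \<rho> k * (E + E))"
    using nE K(1) \<rho>_nonneg by (intro sum_mono mult_left_mono add_mono) auto
  also have "\<dots> \<le> (\<Sum>k<N. \<rho> k * (E + E))"
    using K n_nonneg[of K] \<rho>_nonneg by (intro sum_mono2) auto
  also have "\<dots> = 2 * (\<Sum>k<N. \<rho> k) * E"
    by (simp add: sum_distrib_right[symmetric])
  finally have "E * E \<le> 2 * (\<Sum>k<N. \<rho> k) * E" by (simp add: power2_eq_square)
  moreover have "0 \<le> (\<Sum>k<N. \<rho> k)" using \<rho>_nonneg by (intro sum_nonneg) auto
  ultimately have "E \<le> 2 * (\<Sum>k<N. \<rho> k)"
    using n_nonneg[of K] K(2) by (cases "E = 0") auto
  then show ?thesis using nE[OF \<open>k \<le> N\<close>] by (simp add: n_def A_def)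
qed

section \<open>Consistency of the fractional terms\<close>

text \<open>Integration by parts raises the exponent of the kernel at the price of a boundary term
  at \<open>s = 0\<close>. For \<open>p < 1\<close> the kernel is unbounded near
  \<open>s = t\<close>, but the antiderivative is continuous up to \<open>t\<close>, so the
  fundamental theorem with derivatives on the open interval applies and yields integrability
  too.\<close>

lemma fractional_by_parts:
  fixes F F' :: "real \<Rightarrow> real"
  assumes "0 \<le> t" "0 < p"
    and der: "\<And>s. s \<in> {0..t} \<Longrightarrow> (F has_real_derivative F' s) (at s within {0..t})"
    and cont: "continuous_on {0..t} F'"
  shows "((\<lambda>s. F s * (t - s) powr (p - 1)) has_integral
      F 0 * t powr p / p + integral {0..t} (\<lambda>s. F' s * (t - s) powr p) / p) {0..t}"
proof -
  have contF: "continuous_on {0..t} F"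
    by (rule DERIV_continuous_on[OF der])
  have contp: "continuous_on {0..t} (\<lambda>s. (t - s) powr p)"
    using assms by (intro continuous_on_powr' continuous_intros) auto
  have "((\<lambda>s. F' s * (- ((t - s) powr p) / p) + F s * (t - s) powr (p - 1)) has_integral
      F t * (- ((t - t) powr p) / p) - F 0 * (- ((t - 0) powr p) / p)) {0..t}"
  proof (rule fundamental_theorem_of_calculus_interior)
    show "continuous_on {0..t} (\<lambda>s. F s * (- ((t - s) powr p) / p))"
      using \<open>0 < p\<close>
      by (intro continuous_on_mult contF continuous_on_divide continuous_on_minus contp continuous_on_const) auto
    fix s assume s: "s \<in> {0<..<t}"
    have "(F has_real_derivative F' s) (at s)"
      using der[of s] s at_within_Icc_at[of 0 s t] by auto
    then have "((\<lambda>s. F s * (- ((t - s) powr p) / p)) has_real_derivative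
        (F' s * (- ((t - s) powr p) / p) + F s * (t - s) powr (p - 1))) (at s)"
      using s \<open>0 < p\<close> by (auto intro!: derivative_eq_intros simp: diff_divide_distrib)
    then show "((\<lambda>s. F s * (- ((t - s) powr p) / p)) has_vector_derivative
        (F' s * (- ((t - s) powr p) / p) + F s * (t - s) powr (p - 1))) (at s)"
      by (simp add: has_real_derivative_iff_has_vector_derivative)
  qed (use assms in auto)
  moreover have "(\<lambda>s. F' s * (t - s) powr p) integrable_on {0..t}"
    by (intro integrable_continuous_interval continuous_on_mult cont contp)
  then have "((\<lambda>s. F' s * (t - s) powr p / p) has_integral
      integral {0..t} (\<lambda>s. F' s * (t - s) powr p) / p) {0..t}"
    by (intro has_integral_divide integrable_integral)
  ultimately have "((\<lambda>s. F' s * (- ((t - s) powr p) / p) + F s * (t - s) powr (p - 1)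
        + F' s * (t - s) powr p / p) has_integral
      F t * (- ((t - t) powr p) / p) - F 0 * (- ((t - 0) powr p) / p)
        + integral {0..t} (\<lambda>s. F' s * (t - s) powr p) / p) {0..t}"
    by (rule has_integral_add)
  then show ?thesis using \<open>0 < p\<close> by simp
qed

text \<open>The truncated power. It extends the kernel by zero to \<open>s > t\<close>, so
  fractional integrals at different times \<open>t\<close> become integrals over one interval
  \<open>{0..T}\<close> and can be combined under one integral sign.\<close>

definition powp :: "real \<Rightarrow> real \<Rightarrow> real" where
  "powp p y = max 0 y powr p"

lemma powp_nonneg [simp]: "0 \<le> y \<Longrightarrow> powp p y = y powr p"
  and powp_nonpos [simp]: "y \<le> 0 \<Longrightarrow> powp p y = 0"
  by (auto simp: powp_def max_def)

lemma powp_mono: "0 \<le> p \<Longrightarrow> x \<le> y \<Longrightarrow> powp p x \<le> powp p y"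
  by (auto simp: powp_def intro!: powr_mono2)

lemma continuous_on_powp [continuous_intros]:
  assumes "p > 0" "continuous_on S f"
  shows "continuous_on S (\<lambda>x. powp p (f x))"
  unfolding powp_def using assms by (intro continuous_on_powr' continuous_intros) auto

lemma powp_has_real_derivative:
  assumes "p > 1"
  shows "(powp p has_real_derivative p * powp (p - 1) y) (at y)"
proof -
  consider "y > 0" | "y < 0" | "y = 0" by linarith
  then show ?thesis
  proof cases
    case 1
    then have "((\<lambda>y. y powr p) has_real_derivative p * powp (p - 1) y) (at y)"
      by (auto intro!: derivative_eq_intros)
    moreover have "eventually (\<lambda>z. z \<in> {0<..}) (nhds y)"
      using 1 by (intro eventually_nhds_in_open) auto
    ultimately show ?thesis
      by (subst DERIV_cong_ev[OF refl _ refl]) (auto elim!: eventually_mono)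
  next
    case 2
    then have "((\<lambda>y. 0) has_real_derivative p * powp (p - 1) y) (at y)"
      by simp
    moreover have "eventually (\<lambda>z. z \<in> {..<0}) (nhds y)"
      using 2 by (intro eventually_nhds_in_open) auto
    ultimately show ?thesis
      by (subst DERIV_cong_ev[OF refl _ refl]) (auto elim!: eventually_mono)
  next
    case 3
    have "continuous_on UNIV (\<lambda>h. powp (p - 1) h)"
      using assms by (intro continuous_intros) auto
    then have "isCont (powp (p - 1)) 0"
      by (simp add: continuous_on_eq_continuous_at)
    then have "(powp (p - 1) \<longlongrightarrow> 0) (at 0)"
      by (simp add: isCont_def)
    moreover have "powp (p - 1) h = (powp p (0 + h) - powp p 0) / h" if "h \<noteq> 0" for h
      using that by (cases "h > 0") (auto simp: powr_diff)
    then have "eventually (\<lambda>h. powp (p - 1) h = (powp p (0 + h) - powp p 0) / h) (at 0)"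
      by (auto simp: eventually_at_filter)
    ultimately have "((\<lambda>h. (powp p (0 + h) - powp p 0) / h) \<longlongrightarrow> 0) (at 0)"
      by (subst (asm) tendsto_cong) auto
    then show ?thesis using 3 by (simp add: DERIV_def)
  qed
qed

text \<open>It is meant for truncated powers with \<open>\<psi>\<close> a multiple of
  \<open>powp (1 - \<alpha>)\<close>, whose derivative is unbounded near \<open>0\<close>.
  Monotonicity of \<open>\<psi>\<close> takes the place of a bound on the third derivative of
  \<open>\<Phi>\<close>, and increments of \<open>\<psi>\<close> telescope over the time
  steps.\<close>

lemma midpoint_error:
  fixes \<Phi> \<phi> \<psi> :: "real \<Rightarrow> real"
  assumes d1: "\<And>y. (\<Phi> has_real_derivative \<phi> y) (at y)"
    and d2: "\<And>y. (\<phi> has_real_derivative \<psi> y) (at y)"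
    and "mono \<psi>" "0 < \<tau>"
  shows "\<bar>\<Phi> (y + \<tau>) - \<Phi> y - \<tau> * \<phi> (y + \<tau> / 2)\<bar> \<le> \<tau>\<^sup>2 * (\<psi> (y + \<tau>) - \<psi> y)"
proof -
  define c where "c = y + \<tau> / 2"
  \<comment> \<open>The midpoint error as a function of half the step length; its derivative is a
    second difference of \<open>\<phi>\<close> about \<open>c\<close>.\<close>
  define D where "D \<theta> = \<Phi> (c + \<theta>) - \<Phi> (c - \<theta>) - 2 * \<theta> * \<phi> c" for \<theta>
  have "(D has_real_derivative \<phi> (c + \<theta>) + \<phi> (c - \<theta>) - 2 * \<phi> c) (at \<theta>)" for \<theta>
    unfolding D_def
    by (auto intro!: derivative_eq_intros DERIV_chain2[OF d1])
  then obtain \<xi> where \<xi>: "0 < \<xi>" "\<xi> < \<tau> / 2"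
      "D (\<tau> / 2) - D 0 = (\<tau> / 2 - 0) * (\<phi> (c + \<xi>) + \<phi> (c - \<xi>) - 2 * \<phi> c)"
    using MVT2[of 0 "\<tau> / 2" D "\<lambda>\<theta>. \<phi> (c + \<theta>) + \<phi> (c - \<theta>) - 2 * \<phi> c"] \<open>0 < \<tau>\<close> by auto
  obtain z1 where z1: "c < z1" "z1 < c + \<xi>" "\<phi> (c + \<xi>) - \<phi> c = (c + \<xi> - c) * \<psi> z1"
    using MVT2[of c "c + \<xi>" \<phi> \<psi>] \<xi> d2 by auto
  obtain z2 where z2: "c - \<xi> < z2" "z2 < c" "\<phi> c - \<phi> (c - \<xi>) = (c - (c - \<xi>)) * \<psi> z2"
    using MVT2[of "c - \<xi>" c \<phi> \<psi>] \<xi> d2 by auto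
  have le: "0 \<le> \<psi> z1 - \<psi> z2" "\<psi> z1 - \<psi> z2 \<le> \<psi> (y + \<tau>) - \<psi> y"
    using monoD[OF \<open>mono \<psi>\<close>, of z2 z1] monoD[OF \<open>mono \<psi>\<close>, of z1 "y + \<tau>"]
      monoD[OF \<open>mono \<psi>\<close>, of y z2] z1 z2 \<xi> by (auto simp: c_def)
  have "\<phi> (c + \<xi>) + \<phi> (c - \<xi>) - 2 * \<phi> c = \<xi> * (\<psi> z1 - \<psi> z2)"
    using z1 z2 by (simp add: algebra_simps)
  then have "D (\<tau> / 2) = \<tau> / 2 * \<xi> * (\<psi> z1 - \<psi> z2)"
    using \<xi>(3) by (simp add: D_def)
  moreover have "\<tau> / 2 * \<xi> \<le> \<tau> * \<tau>" using \<xi> \<open>0 < \<tau>\<close> by (intro mult_mono) auto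
  moreover have "D (\<tau> / 2) = \<Phi> (y + \<tau>) - \<Phi> y - \<tau> * \<phi> (y + \<tau> / 2)"
    by (simp add: D_def c_def algebra_simps)
  moreover have "0 \<le> \<tau> / 2 * \<xi> * (\<psi> z1 - \<psi> z2)"
    using le \<xi> \<open>0 < \<tau>\<close> by (intro mult_nonneg_nonneg) auto
  moreover have "\<tau> / 2 * \<xi> * (\<psi> z1 - \<psi> z2) \<le> \<tau> * \<tau> * (\<psi> (y + \<tau>) - \<psi> y)"
    using le \<xi> \<open>0 < \<tau>\<close> \<open>\<tau> / 2 * \<xi> \<le> \<tau> * \<tau>\<close> by (intro mult_mono) auto
  ultimately show ?thesis by (simp only: power2_eq_square)
qed

text \<open>Two integrations by parts: a Taylor formula at \<open>0\<close> for the fractional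
  integral, which isolates the nonsmooth powers of \<open>t\<close> and leaves a remainder with a
  kernel of exponent \<open>p + 1\<close>.\<close>

lemma fractional_expansion:
  fixes F F' F'' :: "real \<Rightarrow> real"
  assumes "0 \<le> t" "t \<le> T" "0 < p"
    and F: "\<And>s. s \<in> {0..T} \<Longrightarrow> (F has_real_derivative F' s) (at s within {0..T})"
    and F': "\<And>s. s \<in> {0..T} \<Longrightarrow> (F' has_real_derivative F'' s) (at s within {0..T})"
    and cont: "continuous_on {0..T} F''"
  shows "integral {0..t} (\<lambda>s. F s * (t - s) powr (p - 1)) / Gamma p
    = F 0 * t powr p / Gamma (p + 1) + F' 0 * t powr (p + 1) / Gamma (p + 2)
      + integral {0..T} (\<lambda>s. F'' s * powp (p + 1) (t - s)) / Gamma (p + 2)"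
proof -
  have sub: "{0..t} \<subseteq> {0..T}" using assms by auto
  have contF': "continuous_on {0..T} F'" by (rule DERIV_continuous_on[OF F'])
  have Ft: "(F has_real_derivative F' s) (at s within {0..t})"
       "(F' has_real_derivative F'' s) (at s within {0..t})" if "s \<in> {0..t}" for s
    using that sub by (auto intro!: DERIV_subset[OF F] DERIV_subset[OF F'])
  have i1: "integral {0..t} (\<lambda>s. F s * (t - s) powr (p - 1))
      = F 0 * t powr p / p + integral {0..t} (\<lambda>s. F' s * (t - s) powr p) / p"
    using assms Ft contF' sub
    by (intro integral_unique fractional_by_parts) (auto intro: continuous_on_subset)
  have "integral {0..t} (\<lambda>s. F' s * (t - s) powr (p + 1 - 1))
      = F' 0 * t powr (p + 1) / (p + 1) + integral {0..t} (\<lambda>s. F'' s * (t - s) powr (p + 1)) / (p + 1)"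
    using assms Ft cont sub
    by (intro integral_unique fractional_by_parts) (auto intro: continuous_on_subset)
  then have i2: "integral {0..t} (\<lambda>s. F' s * (t - s) powr p)
      = F' 0 * t powr (p + 1) / (p + 1) + integral {0..t} (\<lambda>s. F'' s * (t - s) powr (p + 1)) / (p + 1)"
    by simp
  have "integral {0..t} (\<lambda>s. F'' s * powp (p + 1) (t - s)) + integral {t..T} (\<lambda>s. F'' s * powp (p + 1) (t - s))
      = integral {0..T} (\<lambda>s. F'' s * powp (p + 1) (t - s))"
    using assms by (intro Henstock_Kurzweil_Integration.integral_combine integrable_continuous_interval continuous_intros) auto
  moreover have "integral {t..T} (\<lambda>s. F'' s * powp (p + 1) (t - s)) = integral {t..T} (\<lambda>s. 0)"
    by (intro Henstock_Kurzweil_Integration.integral_cong) auto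
  moreover have "integral {0..t} (\<lambda>s. F'' s * powp (p + 1) (t - s)) = integral {0..t} (\<lambda>s. F'' s * (t - s) powr (p + 1))"
    by (intro Henstock_Kurzweil_Integration.integral_cong) auto
  ultimately have i3: "integral {0..t} (\<lambda>s. F'' s * (t - s) powr (p + 1)) = integral {0..T} (\<lambda>s. F'' s * powp (p + 1) (t - s))"
    by simp
  have g1: "Gamma (p + 1) = p * Gamma p" and g2: "Gamma (p + 2) = (p + 1) * (p * Gamma p)"
    using \<open>0 < p\<close> Gamma_plus1[of p] Gamma_plus1[of "p + 1"] by (auto simp: nonpos_Ints_def add.assoc)
  define m g where "m = p + 1" and "g = Gamma p"
  have "g > 0" using \<open>0 < p\<close> unfolding g_def by (rule Gamma_real_pos)
  moreover have "m > 0" using \<open>0 < p\<close> by (simp add: m_def)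
  ultimately show ?thesis
    unfolding i1 i2 i3 g1 g2 unfolding m_def[symmetric] g_def[symmetric] using \<open>0 < p\<close> by (simp add: field_simps)
qed

text \<open>A Peano kernel argument. In the expansions at \<open>a\<close>,
  \<open>a + \<tau>\<close> and \<open>c\<close> the \<open>F 0\<close> terms cancel exactly; the
  rest is the midpoint error \<open>K\<close> of a truncated power, taken at \<open>a\<close> with
  factor \<open>F' 0\<close> and at \<open>a - s\<close> integrated against \<open>F''\<close>. The
  first part yields the increments of exponent \<open>1 - \<alpha>\<close>, the second those of
  exponent \<open>2 - \<alpha>\<close>.\<close>

lemma fractional_midpoint_error:
  fixes F F' F'' :: "real \<Rightarrow> real"
  assumes "0 < \<alpha>" "\<alpha> < 1" "0 \<le> a" "0 < \<tau>" "a + \<tau> \<le> T"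
    and F: "\<And>s. s \<in> {0..T} \<Longrightarrow> (F has_real_derivative F' s) (at s within {0..T})"
    and F': "\<And>s. s \<in> {0..T} \<Longrightarrow> (F' has_real_derivative F'' s) (at s within {0..T})"
    and cont: "continuous_on {0..T} F''"
    and B: "\<bar>F' 0\<bar> \<le> B" "\<And>s. s \<in> {0..T} \<Longrightarrow> \<bar>F'' s\<bar> \<le> B"
  defines "c \<equiv> a + \<tau> / 2"
    and "J \<equiv> (\<lambda>t. integral {0..t} (\<lambda>s. F s * (t - s) powr (1 - \<alpha>)) / Gamma (2 - \<alpha>))"
  shows "\<bar>\<tau> * (integral {0..c} (\<lambda>s. F s * (c - s) powr (- \<alpha>)) / Gamma (1 - \<alpha>)
        - F 0 * c powr (1 - \<alpha>) / Gamma (2 - \<alpha>))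
      - (J (a + \<tau>) - J a - F 0 * ((a + \<tau>) powr (2 - \<alpha>) - a powr (2 - \<alpha>)) / Gamma (3 - \<alpha>))\<bar>
    \<le> B * \<tau>\<^sup>2 / Gamma (3 - \<alpha>) * ((2 - \<alpha>) * ((a + \<tau>) powr (1 - \<alpha>) - a powr (1 - \<alpha>))
        + ((a + \<tau>) powr (2 - \<alpha>) - a powr (2 - \<alpha>)))" (is "\<bar>?X\<bar> \<le> ?R")
proof -
  define \<Phi> \<phi> \<psi> where "\<Phi> y = powp (3 - \<alpha>) y / (3 - \<alpha>)" and "\<phi> y = powp (2 - \<alpha>) y"
    and "\<psi> y = (2 - \<alpha>) * powp (1 - \<alpha>) y" for y
  define K where "K y = \<Phi> (y + \<tau>) - \<Phi> y - \<tau> * \<phi> (y + \<tau> / 2)" for y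
  have d1: "(\<Phi> has_real_derivative \<phi> y) (at y)" for y
    using DERIV_cdivide[OF powp_has_real_derivative[of "3 - \<alpha>" y], of "3 - \<alpha>"] assms
    by (simp add: \<Phi>_def[abs_def] \<phi>_def)
  have d2: "(\<phi> has_real_derivative \<psi> y) (at y)" for y
    using powp_has_real_derivative[of "2 - \<alpha>" y] assms by (simp add: \<psi>_def \<phi>_def[abs_def])
  have mono: "mono \<psi>" using assms by (auto simp: \<psi>_def mono_def intro!: powp_mono)
  have K: "\<bar>K y\<bar> \<le> \<tau>\<^sup>2 * (\<psi> (y + \<tau>) - \<psi> y)" for y
    unfolding K_def by (rule midpoint_error[OF d1 d2 mono \<open>0 < \<tau>\<close>])
  have c: "0 \<le> c" "c \<le> T" using assms by (auto simp: c_def)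
  define I where "I p t = integral {0..T} (\<lambda>s. F'' s * powp p (t - s))" for p t
  have w: "integral {0..c} (\<lambda>s. F s * (c - s) powr (- \<alpha>)) / Gamma (1 - \<alpha>)
      = F 0 * c powr (1 - \<alpha>) / Gamma (2 - \<alpha>) + F' 0 * c powr (2 - \<alpha>) / Gamma (3 - \<alpha>)
        + I (2 - \<alpha>) c / Gamma (3 - \<alpha>)"
    using fractional_expansion[OF c, of "1 - \<alpha>" F F' F''] assms by (simp add: I_def add.commute)
  have J: "J t = F 0 * t powr (2 - \<alpha>) / Gamma (3 - \<alpha>) + F' 0 * t powr (3 - \<alpha>) / Gamma (4 - \<alpha>)
        + I (3 - \<alpha>) t / Gamma (4 - \<alpha>)" if "0 \<le> t" "t \<le> T" for t
    using fractional_expansion[OF that, of "2 - \<alpha>" F F' F''] assms by (simp add: I_def J_def add.commute)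
  have g: "Gamma (4 - \<alpha>) = (3 - \<alpha>) * Gamma (3 - \<alpha>)"
    using Gamma_plus1[of "3 - \<alpha>"] assms by (simp add: nonpos_Ints_def add.commute)
  have gpos: "Gamma (3 - \<alpha>) > 0" using assms by (intro Gamma_real_pos) auto
  have int: "(\<lambda>s. F'' s * powp p (t - s)) integrable_on {0..T}" if "p > 0" for p t
    using that cont by (intro integrable_continuous_interval continuous_intros) auto
  define IK where "IK = integral {0..T} (\<lambda>s. F'' s * K (a - s))"
  have "IK = integral {0..T} (\<lambda>s. F'' s * powp (3 - \<alpha>) (a + \<tau> - s) / (3 - \<alpha>)
      - F'' s * powp (3 - \<alpha>) (a - s) / (3 - \<alpha>) - \<tau> * (F'' s * powp (2 - \<alpha>) (c - s)))"
    unfolding IK_def K_def \<Phi>_def \<phi>_def c_def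
    by (intro Henstock_Kurzweil_Integration.integral_cong) (simp add: algebra_simps)
  also have "\<dots> = I (3 - \<alpha>) (a + \<tau>) / (3 - \<alpha>) - I (3 - \<alpha>) a / (3 - \<alpha>) - \<tau> * I (2 - \<alpha>) c"
    using assms(2) unfolding I_def
    by (intro integral_unique has_integral_diff has_integral_divide has_integral_mult_right
        integrable_integral int) auto
  finally have IK: "IK = I (3 - \<alpha>) (a + \<tau>) / (3 - \<alpha>) - I (3 - \<alpha>) a / (3 - \<alpha>) - \<tau> * I (2 - \<alpha>) c" .
  define q where "q = 3 - \<alpha>"
  have q: "q > 0" using assms by (simp add: q_def)
  define g3 where "g3 = Gamma (3 - \<alpha>)"
  have J1: "J a = F 0 * a powr (2 - \<alpha>) / g3 + F' 0 * a powr q / (q * g3) + I q a / (q * g3)"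
    and J2: "J (a + \<tau>) = F 0 * (a + \<tau>) powr (2 - \<alpha>) / g3 + F' 0 * (a + \<tau>) powr q / (q * g3)
        + I q (a + \<tau>) / (q * g3)"
    using J[of a] J[of "a + \<tau>"] g assms(3-5) by (simp_all add: q_def g3_def)
  have Ka: "K a = (a + \<tau>) powr q / q - a powr q / q - \<tau> * c powr (2 - \<alpha>)"
    using assms(3-5) by (simp add: K_def \<Phi>_def \<phi>_def c_def q_def)
  have X: "?X = - (F' 0 * K a + IK) / Gamma (3 - \<alpha>)"
    unfolding w IK J1 J2 Ka g3_def[symmetric] unfolding q_def[symmetric]
    using gpos[folded g3_def] q by (simp add: field_simps)
  \<comment> \<open>Integration over \<open>s\<close> turns the increment of \<open>\<psi>\<close>
    that bounds \<open>K (a - s)\<close> into an increment of \<open>\<phi>\<close>; the end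
    \<open>s = T\<close> contributes nothing because \<open>t - T \<le> 0\<close>.\<close>
  have "((\<lambda>s. \<psi> (t - s)) has_integral powp (2 - \<alpha>) t) {0..T}" if "0 \<le> t" "t \<le> T" for t
  proof -
    have "((\<lambda>s. \<psi> (t - s)) has_integral (- \<phi> (t - T)) - (- \<phi> (t - 0))) {0..T}"
      using assms
      by (intro fundamental_theorem_of_calculus)
        (auto simp: has_real_derivative_iff_has_vector_derivative[symmetric]
          intro!: derivative_eq_intros DERIV_chain2[OF d2])
    then show ?thesis using that by (simp add: \<phi>_def)
  qed
  then have i1: "((\<lambda>s. B * \<tau>\<^sup>2 * (\<psi> (a + \<tau> - s) - \<psi> (a - s))) has_integral
      B * \<tau>\<^sup>2 * (powp (2 - \<alpha>) (a + \<tau>) - powp (2 - \<alpha>) a)) {0..T}"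
    using assms by (intro has_integral_mult_right has_integral_diff) auto
  have i2: "(\<lambda>s. F'' s * K (a - s)) integrable_on {0..T}"
    unfolding K_def \<Phi>_def \<phi>_def using assms
    by (intro integrable_continuous_interval continuous_intros) auto
  have i3: "norm (F'' s * K (a - s)) \<le> B * \<tau>\<^sup>2 * (\<psi> (a + \<tau> - s) - \<psi> (a - s))"
    if "s \<in> {0..T}" for s
    using mult_mono[OF B(2)[OF that] K[of "a - s"]] B(1)
    by (simp add: abs_mult algebra_simps)
  have "norm IK \<le> B * \<tau>\<^sup>2 * (powp (2 - \<alpha>) (a + \<tau>) - powp (2 - \<alpha>) a)"
    using Henstock_Kurzweil_Integration.integral_norm_bound_integral[OF i2 has_integral_integrable[OF i1] i3]
    unfolding IK_def integral_unique[OF i1] .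
  then have IK_le: "\<bar>IK\<bar> \<le> B * \<tau>\<^sup>2 * ((a + \<tau>) powr (2 - \<alpha>) - a powr (2 - \<alpha>))"
    using assms by simp
  have "\<bar>F' 0 * K a\<bar> \<le> B * (\<tau>\<^sup>2 * (\<psi> (a + \<tau>) - \<psi> a))"
    unfolding abs_mult using B(1) K by (intro mult_mono) auto
  also have "\<dots> = B * \<tau>\<^sup>2 * ((2 - \<alpha>) * ((a + \<tau>) powr (1 - \<alpha>) - a powr (1 - \<alpha>)))"
    using assms by (simp add: \<psi>_def algebra_simps)
  finally have "\<bar>F' 0 * K a + IK\<bar> \<le> B * \<tau>\<^sup>2 * ((2 - \<alpha>) * ((a + \<tau>) powr (1 - \<alpha>) - a powr (1 - \<alpha>))
        + ((a + \<tau>) powr (2 - \<alpha>) - a powr (2 - \<alpha>)))"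
    using IK_le by (simp only: distrib_left)
  then have "\<bar>F' 0 * K a + IK\<bar> / Gamma (3 - \<alpha>) \<le> B * \<tau>\<^sup>2 * ((2 - \<alpha>) * ((a + \<tau>) powr (1 - \<alpha>) - a powr (1 - \<alpha>))
        + ((a + \<tau>) powr (2 - \<alpha>) - a powr (2 - \<alpha>))) / Gamma (3 - \<alpha>)"
    using gpos by (intro divide_right_mono) auto
  then show ?thesis
    unfolding X using gpos by (simp only: abs_divide abs_minus_cancel abs_of_pos) simp
qed

text \<open>\<open>f\<close> minus its mean \<open>c\<close> integrates to zero, so the constant
  \<open>w \<tau>\<close> can be subtracted from the weight. Then \<open>f - c\<close> is at most
  \<open>B * \<tau>\<close>, as \<open>c\<close> is a value of \<open>f\<close>, and the reduced
  weight is at most \<open>w 0 - w \<tau>\<close>. No smoothness of \<open>w\<close> enters, and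
  these differences telescope over the lags.\<close>

lemma weighted_cell_error:
  fixes U f f' w :: "real \<Rightarrow> real"
  assumes "0 < \<tau>"
    and U: "\<And>s. s \<in> {0..\<tau>} \<Longrightarrow> (U has_real_derivative f s) (at s within {0..\<tau>})"
    and f: "\<And>s. s \<in> {0..\<tau>} \<Longrightarrow> (f has_real_derivative f' s) (at s within {0..\<tau>})"
    and B: "\<And>s. s \<in> {0..\<tau>} \<Longrightarrow> \<bar>f' s\<bar> \<le> B"
    and w: "continuous_on {0..\<tau>} w" "antimono_on {0..\<tau>} w"
  shows "\<bar>integral {0..\<tau>} (\<lambda>s. f s * w s) - (U \<tau> - U 0) / \<tau> * integral {0..\<tau>} w\<bar>
    \<le> B * \<tau>\<^sup>2 * (w 0 - w \<tau>)"
proof -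
  define c where "c = (U \<tau> - U 0) / \<tau>"
  have contf: "continuous_on {0..\<tau>} f" by (rule DERIV_continuous_on[OF f])
  have "(f has_integral U \<tau> - U 0) {0..\<tau>}"
    using assms(1) U by (intro fundamental_theorem_of_calculus)
      (auto simp: has_real_derivative_iff_has_vector_derivative[symmetric])
  moreover have "((\<lambda>s. c) has_integral (\<tau> - 0) *\<^sub>R c) {0..\<tau>}"
    using assms(1) has_integral_const_real[of c 0 \<tau>] by simp
  ultimately have "((\<lambda>s. f s - c) has_integral U \<tau> - U 0 - (\<tau> - 0) *\<^sub>R c) {0..\<tau>}"
    by (rule has_integral_diff)
  then have "((\<lambda>s. f s - c) has_integral 0) {0..\<tau>}"
    using assms(1) by (simp add: c_def)
  then have i0: "((\<lambda>s. w \<tau> * (f s - c)) has_integral w \<tau> * 0) {0..\<tau>}"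
    by (rule has_integral_mult_right)
  have i1: "((\<lambda>s. f s * w s) has_integral integral {0..\<tau>} (\<lambda>s. f s * w s)) {0..\<tau>}"
    by (intro integrable_integral integrable_continuous_interval continuous_on_mult contf w)
  have i2: "((\<lambda>s. c * w s) has_integral c * integral {0..\<tau>} w) {0..\<tau>}"
    by (intro has_integral_mult_right integrable_integral integrable_continuous_interval w)
  have i3: "((\<lambda>s. (f s - c) * (w s - w \<tau>)) has_integral
      integral {0..\<tau>} (\<lambda>s. f s * w s) - c * integral {0..\<tau>} w) {0..\<tau>}"
    using has_integral_diff[OF has_integral_diff[OF i1 i2] i0] by (simp add: algebra_simps)
  obtain \<xi> where \<xi>: "\<xi> \<in> {0<..<\<tau>}" "U \<tau> - U 0 = (\<tau> - 0) * f \<xi>"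
  proof -
    have "\<exists>\<xi>\<in>{0<..<\<tau>}. U \<tau> - U 0 = (\<lambda>h. f \<xi> * h) (\<tau> - 0)"
      using assms(1) U by (intro mvt_simple) (auto simp: has_field_derivative_def)
    then show thesis using that by (auto simp: mult.commute)
  qed
  have "norm ((f s - c) * (w s - w \<tau>)) \<le> B * \<tau> * (w 0 - w \<tau>)" if s: "s \<in> {0..\<tau>}" for s
  proof -
    have "c = f \<xi>" using \<xi> assms(1) by (simp add: c_def)
    then have "norm (f s - c) \<le> B * norm (s - \<xi>)"
      using f B s \<xi> field_differentiable_bound[of "{0..\<tau>}" f f' B s \<xi>] by auto
    also have "\<dots> \<le> B * \<tau>" using s \<xi> B[OF s] by (intro mult_left_mono) auto
    finally have "norm (f s - c) \<le> B * \<tau>" .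
    moreover have "0 \<le> w s - w \<tau>" "w s - w \<tau> \<le> w 0 - w \<tau>"
      using w(2) s assms(1) by (auto simp: monotone_on_def)
    moreover have "0 \<le> B * \<tau>" using B[OF s] assms(1) by simp
    ultimately show ?thesis unfolding norm_mult by (intro mult_mono) auto
  qed
  then have "norm (integral {0..\<tau>} (\<lambda>s. f s * w s) - c * integral {0..\<tau>} w)
      \<le> B * \<tau> * (w 0 - w \<tau>) * measure lborel {0..\<tau>}"
    using has_integral_bound_real[OF _ finite.emptyI i3] B[of 0] w(2) assms(1) by (simp add: monotone_on_def)
  then show ?thesis using assms(1) by (simp add: c_def power2_eq_square mult_ac)
qed

section \<open>Kernel integrals over time cells\<close>

lemma integral_cells:
  fixes g :: "real \<Rightarrow> real"
  assumes "0 \<le> \<tau>" "continuous_on {0..real n * \<tau>} g"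
  shows "integral {0..real n * \<tau>} g = (\<Sum>j<n. integral {0..\<tau>} (\<lambda>s. g (real j * \<tau> + s)))"
  using assms(2)
proof (induction n)
  case (Suc n)
  have le: "real n * \<tau> \<le> real (Suc n) * \<tau>" "0 \<le> real n * \<tau>" using assms(1) by (auto simp: algebra_simps)
  have "integral {0..real (Suc n) * \<tau>} g
      = integral {0..real n * \<tau>} g + integral {real n * \<tau>..real (Suc n) * \<tau>} g"
    using Suc.prems le by (intro Henstock_Kurzweil_Integration.integral_combine[symmetric] integrable_continuous_interval) auto
  also have "integral {real n * \<tau>..real (Suc n) * \<tau>} g = integral {0..\<tau>} (g \<circ> (+) (real n * \<tau>))"
    by (subst integral_shift_Icc_real) (simp add: algebra_simps)
  finally show ?case
    using Suc le continuous_on_subset[OF Suc.prems, of "{0..real n * \<tau>}"] by (simp add: o_def)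
qed simp

text \<open>The origin of \<open>coeff_M\<close>: up to scaling it is the kernel integral over the
  cell at lag \<open>Suc n\<close>.\<close>

lemma integral_kernel_cell:
  fixes \<alpha> \<tau> :: real
  assumes "\<alpha> < 1" "0 < \<tau>"
  shows "integral {0..\<tau>} (\<lambda>s. (real (Suc n) * \<tau> - s) powr (1 - \<alpha>))
    = \<tau> powr (2 - \<alpha>) * coeff_M \<alpha> n / (2 - \<alpha>)"
proof -
  have "0 \<le> real n * \<tau>" "real (Suc n) * \<tau> = \<tau> + real n * \<tau>"
    using assms by (simp, simp add: algebra_simps)
  then have ge: "\<tau> \<le> real (Suc n) * \<tau>" by linarith
  then have ge': "0 \<le> real (Suc n) * \<tau> - s" if "s \<in> {0..\<tau>}" for s
    using that unfolding atLeastAtMost_iff by linarith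
  have "((\<lambda>s. (real (Suc n) * \<tau> - s) powr (1 - \<alpha>)) has_integral
      (- ((real (Suc n) * \<tau> - \<tau>) powr (2 - \<alpha>)) / (2 - \<alpha>))
        - (- ((real (Suc n) * \<tau> - 0) powr (2 - \<alpha>)) / (2 - \<alpha>))) {0..\<tau>}"
  proof (rule fundamental_theorem_of_calculus_interior)
    show "continuous_on {0..\<tau>} (\<lambda>s. - ((real (Suc n) * \<tau> - s) powr (2 - \<alpha>)) / (2 - \<alpha>))"
      using assms ge' by (intro continuous_on_divide continuous_on_minus continuous_on_powr' continuous_intros) auto
    fix s assume s: "s \<in> {0<..<\<tau>}"
    then have "0 < real (Suc n) * \<tau> - s" using ge unfolding greaterThanLessThan_iff by linarith
    then have "((\<lambda>s. - ((real (Suc n) * \<tau> - s) powr (2 - \<alpha>)) / (2 - \<alpha>)) has_real_derivative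
       (real (Suc n) * \<tau> - s) powr (1 - \<alpha>)) (at s)"
      using assms by (auto intro!: derivative_eq_intros)
    then show "((\<lambda>s. - ((real (Suc n) * \<tau> - s) powr (2 - \<alpha>)) / (2 - \<alpha>)) has_vector_derivative
       (real (Suc n) * \<tau> - s) powr (1 - \<alpha>)) (at s)"
      by (simp add: has_real_derivative_iff_has_vector_derivative)
  qed (use assms in auto)
  then have I: "integral {0..\<tau>} (\<lambda>s. (real (Suc n) * \<tau> - s) powr (1 - \<alpha>))
    = ((real (Suc n) * \<tau>) powr (2 - \<alpha>) - (real n * \<tau>) powr (2 - \<alpha>)) / (2 - \<alpha>)"
    by (simp add: integral_unique algebra_simps diff_divide_distrib)
  have p: "(real m * \<tau>) powr (2 - \<alpha>) = real m powr (2 - \<alpha>) * \<tau> powr (2 - \<alpha>)" for m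
    by (rule powr_mult)
  show ?thesis
    unfolding I p coeff_M_def by (simp add: algebra_simps)
qed

text \<open>
  \<open>J\<close> is the antiderivative in time of the Caputo derivative, and the memory term of the scheme is the increment
  of \<open>J\<close> for the piecewise linear interpolant of \<open>u\<close>. Between two consecutive times the cell errors
  \<open>\<epsilon> j m\<close> (cell \<open>j\<close>, lag \<open>m\<close>) are compared at equal lag, which gains a factor \<open>\<tau>\<close>;
  the first cell has no partner, but its errors telescope in time.
\<close>

lemma fractional_interpolation_error:
  fixes u F F' F'' :: "real \<Rightarrow> real"
  assumes "0 < \<alpha>" "\<alpha> < 1" "0 < \<tau>" "real (Suc k) * \<tau> \<le> T"
    and u: "\<And>s. s \<in> {0..T} \<Longrightarrow> (u has_real_derivative F s) (at s within {0..T})"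
    and F: "\<And>s. s \<in> {0..T} \<Longrightarrow> (F has_real_derivative F' s) (at s within {0..T})"
    and F': "\<And>s. s \<in> {0..T} \<Longrightarrow> (F' has_real_derivative F'' s) (at s within {0..T})"
    and B: "\<And>s. s \<in> {0..T} \<Longrightarrow> \<bar>F' s\<bar> \<le> B" "\<And>s. s \<in> {0..T} \<Longrightarrow> \<bar>F'' s\<bar> \<le> B"
  defines "J \<equiv> (\<lambda>t. integral {0..t} (\<lambda>s. F s * (t - s) powr (1 - \<alpha>)) / Gamma (2 - \<alpha>))"
    and "\<delta> \<equiv> (\<lambda>j. u (real (Suc j) * \<tau>) - u (real j * \<tau>))"
    and "q \<equiv> (\<lambda>m. (real m * \<tau>) powr (1 - \<alpha>))"
  shows "\<bar>J (real (Suc k) * \<tau>) - J (real k * \<tau>)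
      - beta \<alpha> \<tau> * (\<delta> k + (\<Sum>j<k. coeff_G \<alpha> (k - j) * \<delta> j))\<bar>
    \<le> B / Gamma (2 - \<alpha>) * (\<tau>\<^sup>2 * (q (Suc k) - q k) + \<tau> ^ 3 * q k)"
proof -
  define I where "I j m = integral {0..\<tau>} (\<lambda>s. F (real j * \<tau> + s) * (real m * \<tau> - s) powr (1 - \<alpha>))" for j m
  define W where "W m = integral {0..\<tau>} (\<lambda>s. (real m * \<tau> - s) powr (1 - \<alpha>))" for m
  define \<epsilon> where "\<epsilon> j m = I j m - \<delta> j / \<tau> * W m" for j m
  have gpos: "Gamma (2 - \<alpha>) > 0" using assms(1,2) by (intro Gamma_real_pos) auto
  then have gne: "Gamma (2 - \<alpha>) \<noteq> 0" by linarith
  have cell: "real (Suc j) * \<tau> \<le> T" "real j * \<tau> \<le> T" if "j \<le> k" for j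
  proof -
    have "real (Suc j) * \<tau> \<le> real (Suc k) * \<tau>" using that assms(3) by (intro mult_right_mono) auto
    then show "real (Suc j) * \<tau> \<le> T" using assms(4) by simp
    then show "real j * \<tau> \<le> T" using assms(3) by (simp add: algebra_simps)
  qed
  have contF: "continuous_on {0..T} F" by (rule DERIV_continuous_on[OF F])
  have shift: "(g has_real_derivative g' (real j * \<tau> + s)) (at (real j * \<tau> + s) within {0..T}) \<Longrightarrow>
      ((\<lambda>s. g (real j * \<tau> + s)) has_real_derivative g' (real j * \<tau> + s)) (at s within {0..\<tau>})"
    if "j \<le> k" for j s and g g' :: "real \<Rightarrow> real"
  proof -
    assume g: "(g has_real_derivative g' (real j * \<tau> + s)) (at (real j * \<tau> + s) within {0..T})"
    have "(\<lambda>s. real j * \<tau> + s) ` {0..\<tau>} \<subseteq> {0..T}"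
      using cell(1)[OF that] assms(3) by (auto simp: algebra_simps)
    from DERIV_subset[OF g this]
    have "((g \<circ> (\<lambda>s. real j * \<tau> + s)) has_real_derivative g' (real j * \<tau> + s) * 1) (at s within {0..\<tau>})"
      by (intro DERIV_image_chain) (auto intro!: derivative_eq_intros)
    then show ?thesis by (simp add: o_def)
  qed
  have mem: "real j * \<tau> + s \<in> {0..T}" if "j \<le> k" "s \<in> {0..\<tau>}" for j s
    using that cell(1)[OF that(1)] assms(3) by (auto simp: algebra_simps)
  have u_shift: "((\<lambda>s. u (real j * \<tau> + s)) has_real_derivative F (real j * \<tau> + s)) (at s within {0..\<tau>})"
    and F_shift: "((\<lambda>s. F (real j * \<tau> + s)) has_real_derivative F' (real j * \<tau> + s)) (at s within {0..\<tau>})"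
    if "j \<le> k" "s \<in> {0..\<tau>}" for j s
    by (rule shift[OF that(1)], rule u F, rule mem[OF that])+
  have kernel: "continuous_on {0..\<tau>} (\<lambda>s. (real (Suc m) * \<tau> - s) powr (1 - \<alpha>))"
       "antimono_on {0..\<tau>} (\<lambda>s. (real (Suc m) * \<tau> - s) powr (1 - \<alpha>))" for m
  proof -
    have nn: "0 \<le> real (Suc m) * \<tau> - s" if "s \<le> \<tau>" for s
    proof -
      have "0 \<le> real m * \<tau>" "real (Suc m) * \<tau> = \<tau> + real m * \<tau>"
        using assms(3) by (simp, simp add: algebra_simps)
      then show ?thesis using that by linarith
    qed
    show "continuous_on {0..\<tau>} (\<lambda>s. (real (Suc m) * \<tau> - s) powr (1 - \<alpha>))"
      using assms(2) nn by (intro continuous_on_powr' continuous_intros) auto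
    show "antimono_on {0..\<tau>} (\<lambda>s. (real (Suc m) * \<tau> - s) powr (1 - \<alpha>))"
      using assms(2) nn by (intro monotone_onI powr_mono2) auto
  qed
  have \<epsilon>0: "\<bar>\<epsilon> 0 (Suc m)\<bar> \<le> B * \<tau>\<^sup>2 * (q (Suc m) - q m)" for m
  proof -
    have "\<bar>\<epsilon> 0 (Suc m)\<bar> \<le> B * \<tau>\<^sup>2 * ((real (Suc m) * \<tau> - 0) powr (1 - \<alpha>) - (real (Suc m) * \<tau> - \<tau>) powr (1 - \<alpha>))"
      using weighted_cell_error[where U = "\<lambda>s. u (real 0 * \<tau> + s)" and f = "\<lambda>s. F (real 0 * \<tau> + s)"
          and f' = "\<lambda>s. F' (real 0 * \<tau> + s)", OF assms(3) _ _ _ kernel, of B m]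
        u_shift[OF le0] F_shift[OF le0] B(1)[OF mem[OF le0]]
      by (simp add: \<epsilon>_def I_def W_def \<delta>_def)
    then show ?thesis by (simp add: q_def algebra_simps)
  qed
  have \<epsilon>d: "\<bar>\<epsilon> (Suc j) (Suc m) - \<epsilon> j (Suc m)\<bar> \<le> B * \<tau> ^ 3 * (q (Suc m) - q m)" if "j < k" for j m
  proof -
    have j: "j \<le> k" "Suc j \<le> k" using that by auto
    \<comment> \<open>\<open>d\<close> compares a function on two neighbouring cells. The cell
      estimate is applied to \<open>d u\<close>, whose second derivative \<open>d F'\<close> is at
      most \<open>B * \<tau>\<close> by the bound on \<open>F''\<close>; this is the extra factor
      \<open>\<tau>\<close>.\<close>
    define d where "d g s = g (real (Suc j) * \<tau> + s) - g (real j * \<tau> + s)" for g :: "real \<Rightarrow> real" and s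
    have "\<bar>d F' s\<bar> \<le> B * \<tau>" if s: "s \<in> {0..\<tau>}" for s
      using field_differentiable_bound[of "{0..T}" F' F'' B "real (Suc j) * \<tau> + s" "real j * \<tau> + s"]
        F' B(2) mem[OF j(1) s] mem[OF j(2) s] assms(3) by (simp add: d_def algebra_simps)
    then have "\<bar>integral {0..\<tau>} (\<lambda>s. d F s * (real (Suc m) * \<tau> - s) powr (1 - \<alpha>)) - (d u \<tau> - d u 0) / \<tau> * W (Suc m)\<bar>
       \<le> B * \<tau> * \<tau>\<^sup>2 * ((real (Suc m) * \<tau> - 0) powr (1 - \<alpha>) - (real (Suc m) * \<tau> - \<tau>) powr (1 - \<alpha>))"
      unfolding W_def
      by (intro weighted_cell_error[where f' = "d F'"] kernel assms(3); unfold d_def)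
         (auto intro!: DERIV_diff u_shift F_shift j simp del: of_nat_Suc)
    moreover have "integral {0..\<tau>} (\<lambda>s. d F s * (real (Suc m) * \<tau> - s) powr (1 - \<alpha>)) = I (Suc j) (Suc m) - I j (Suc m)"
    proof -
      have "(\<lambda>s. F (real i * \<tau> + s) * (real (Suc m) * \<tau> - s) powr (1 - \<alpha>)) integrable_on {0..\<tau>}" if "i \<le> k" for i
        by (intro integrable_continuous_interval continuous_on_mult kernel
           continuous_on_compose2[OF contF] continuous_intros image_subsetI mem[OF that])
      then show ?thesis
        unfolding I_def d_def left_diff_distrib using j
        by (intro Henstock_Kurzweil_Integration.integral_diff) (auto simp del: of_nat_Suc)
    qed
    moreover have "d u \<tau> - d u 0 = \<delta> (Suc j) - \<delta> j"
      by (simp add: d_def \<delta>_def algebra_simps)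
    ultimately show ?thesis
      by (simp add: \<epsilon>_def q_def algebra_simps diff_divide_distrib power2_eq_square power3_eq_cube)
  qed
  have Jsum: "J (real n * \<tau>) = (\<Sum>j<n. I j (n - j)) / Gamma (2 - \<alpha>)" if "n \<le> Suc k" for n
  proof -
    have "real n * \<tau> \<le> T" using that cell(1)[of k] cell(2)[of n] by (cases "n = Suc k") auto
    then have "continuous_on {0..real n * \<tau>} (\<lambda>s. F s * (real n * \<tau> - s) powr (1 - \<alpha>))"
      using assms(2) by (intro continuous_on_mult continuous_on_subset[OF contF] continuous_on_powr' continuous_intros) auto
    then have "integral {0..real n * \<tau>} (\<lambda>s. F s * (real n * \<tau> - s) powr (1 - \<alpha>))
      = (\<Sum>j<n. integral {0..\<tau>} (\<lambda>s. F (real j * \<tau> + s) * (real n * \<tau> - (real j * \<tau> + s)) powr (1 - \<alpha>)))"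
      using assms(3) by (intro integral_cells) auto
    also have "\<dots> = (\<Sum>j<n. I j (n - j))"
      unfolding I_def by (intro sum.cong refl) (simp add: of_nat_diff algebra_simps)
    finally show ?thesis by (simp add: J_def)
  qed
  have \<Gamma>J: "Gamma (2 - \<alpha>) * J (real n * \<tau>) = (\<Sum>j<n. I j (n - j))" if "n \<le> Suc k" for n
    using gne by (simp add: Jsum[OF that])
  have W: "beta \<alpha> \<tau> * coeff_M \<alpha> n * Gamma (2 - \<alpha>) = W (Suc n) / \<tau>" for n
  proof -
    have "Gamma (3 - \<alpha>) = (2 - \<alpha>) * Gamma (2 - \<alpha>)"
      using Gamma_plus1[of "2 - \<alpha>"] assms(2) by (simp add: nonpos_Ints_def add.commute)
    moreover have "\<tau> powr (2 - \<alpha>) = \<tau> * \<tau> powr (1 - \<alpha>)"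
      using assms(3) powr_add[of \<tau> 1 "1 - \<alpha>"] by simp
    ultimately show ?thesis
      using gne assms(1-3) unfolding W_def integral_kernel_cell[OF assms(2,3)]
      by (simp add: beta_def)
  qed
  \<comment> \<open>Since \<open>coeff_M \<alpha> 0 = 1\<close>, the newest increment fits the same
    pattern, and the memory term is a difference of two sums with weights \<open>coeff_M\<close>,
    one for each end of the time step.\<close>
  have "\<delta> k + (\<Sum>j<k. coeff_G \<alpha> (k - j) * \<delta> j)
      = (\<Sum>j<Suc k. coeff_M \<alpha> (k - j) * \<delta> j) - (\<Sum>j<k. coeff_M \<alpha> (k - j - 1) * \<delta> j)"
    by (simp add: coeff_G_def coeff_M_def[of _ 0] sum_subtractf left_diff_distrib)
  then have "Gamma (2 - \<alpha>) * (J (real (Suc k) * \<tau>) - J (real k * \<tau>)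
      - beta \<alpha> \<tau> * (\<delta> k + (\<Sum>j<k. coeff_G \<alpha> (k - j) * \<delta> j)))
     = (\<Sum>j<Suc k. I j (Suc k - j)) - (\<Sum>j<k. I j (k - j)) -
      ((\<Sum>j<Suc k. beta \<alpha> \<tau> * coeff_M \<alpha> (k - j) * Gamma (2 - \<alpha>) * \<delta> j)
      - (\<Sum>j<k. beta \<alpha> \<tau> * coeff_M \<alpha> (k - j - 1) * Gamma (2 - \<alpha>) * \<delta> j))"
    unfolding right_diff_distrib \<Gamma>J[OF le_refl] \<Gamma>J[OF le_SucI[OF le_refl]]
    by (simp only: right_diff_distrib sum_distrib_left mult_ac)
  also have "\<dots> = (\<Sum>j<Suc k. \<epsilon> j (Suc k - j)) - (\<Sum>j<k. \<epsilon> j (k - j))"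
  proof -
    have "(\<Sum>j<Suc k. \<epsilon> j (Suc k - j)) = (\<Sum>j<Suc k. I j (Suc k - j)) - (\<Sum>j<Suc k. W (Suc (k - j)) / \<tau> * \<delta> j)"
      unfolding sum_subtractf[symmetric] by (intro sum.cong refl) (auto simp: \<epsilon>_def Suc_diff_le)
    moreover have "(\<Sum>j<k. \<epsilon> j (k - j)) = (\<Sum>j<k. I j (k - j)) - (\<Sum>j<k. W (Suc (k - j - 1)) / \<tau> * \<delta> j)"
      unfolding sum_subtractf[symmetric] by (intro sum.cong refl) (auto simp: \<epsilon>_def Suc_diff_Suc)
    ultimately show ?thesis unfolding W by simp
  qed
  also have "\<dots> = \<epsilon> 0 (Suc k) + (\<Sum>j<k. \<epsilon> (Suc j) (k - j) - \<epsilon> j (k - j))"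
    by (subst sum.lessThan_Suc_shift) (simp add: sum_subtractf)
  finally have eq: "Gamma (2 - \<alpha>) * (J (real (Suc k) * \<tau>) - J (real k * \<tau>)
      - beta \<alpha> \<tau> * (\<delta> k + (\<Sum>j<k. coeff_G \<alpha> (k - j) * \<delta> j)))
     = \<epsilon> 0 (Suc k) + (\<Sum>j<k. \<epsilon> (Suc j) (k - j) - \<epsilon> j (k - j))" .
  have "\<bar>\<Sum>j<k. \<epsilon> (Suc j) (k - j) - \<epsilon> j (k - j)\<bar> \<le> (\<Sum>j<k. B * \<tau> ^ 3 * (q (k - j) - q (k - Suc j)))"
  proof (rule order_trans[OF sum_abs sum_mono])
    fix j assume "j \<in> {..<k}"
    then have "j < k" "k - j = Suc (k - Suc j)" by auto
    then show "\<bar>\<epsilon> (Suc j) (k - j) - \<epsilon> j (k - j)\<bar> \<le> B * \<tau> ^ 3 * (q (k - j) - q (k - Suc j))"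
      using \<epsilon>d[of j "k - Suc j"] by simp
  qed
  also have "\<dots> = B * \<tau> ^ 3 * (\<Sum>j<k. q (k - j) - q (k - Suc j))"
    by (simp add: sum_distrib_left)
  also have "(\<Sum>j<k. q (k - j) - q (k - Suc j)) = q k"
    using sum_lessThan_telescope'[of "\<lambda>j. q (k - j)" k] by (simp add: q_def)
  finally have "\<bar>\<epsilon> 0 (Suc k) + (\<Sum>j<k. \<epsilon> (Suc j) (k - j) - \<epsilon> j (k - j))\<bar>
      \<le> B * \<tau>\<^sup>2 * (q (Suc k) - q k) + B * \<tau> ^ 3 * q k"
    using \<epsilon>0[of k] by linarith
  then have "Gamma (2 - \<alpha>) * \<bar>J (real (Suc k) * \<tau>) - J (real k * \<tau>)
      - beta \<alpha> \<tau> * (\<delta> k + (\<Sum>j<k. coeff_G \<alpha> (k - j) * \<delta> j))\<bar>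
      \<le> B * \<tau>\<^sup>2 * (q (Suc k) - q k) + B * \<tau> ^ 3 * q k"
    unfolding eq[symmetric] abs_mult using gpos by simp
  then show ?thesis
    using gpos by (simp add: field_simps)
qed

text \<open>\<open>J\<close> is eliminated between the midpoint error and the interpolation error.
  The increment of \<open>F 0 * t powr (2 - \<alpha>) / Gamma (3 - \<alpha>)\<close> is exactly the
  \<open>coeff_M\<close> term of the scheme.\<close>

lemma fractional_scheme_error:
  fixes u F F' F'' :: "real \<Rightarrow> real"
  assumes "0 < \<alpha>" "\<alpha> < 1" "0 < \<tau>" "real (Suc k) * \<tau> \<le> T"
    and u: "\<And>s. s \<in> {0..T} \<Longrightarrow> (u has_real_derivative F s) (at s within {0..T})"
    and F: "\<And>s. s \<in> {0..T} \<Longrightarrow> (F has_real_derivative F' s) (at s within {0..T})"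
    and F': "\<And>s. s \<in> {0..T} \<Longrightarrow> (F' has_real_derivative F'' s) (at s within {0..T})"
    and cont: "continuous_on {0..T} F''"
    and B: "\<And>s. s \<in> {0..T} \<Longrightarrow> \<bar>F' s\<bar> \<le> B" "\<And>s. s \<in> {0..T} \<Longrightarrow> \<bar>F'' s\<bar> \<le> B"
  defines "\<delta> \<equiv> (\<lambda>j. u (real (Suc j) * \<tau>) - u (real j * \<tau>))"
    and "q \<equiv> (\<lambda>m. (real m * \<tau>) powr (1 - \<alpha>))"
    and "p \<equiv> (\<lambda>m. (real m * \<tau>) powr (2 - \<alpha>))"
    and "c \<equiv> (real k + 1/2) * \<tau>"
  shows "\<bar>beta \<alpha> \<tau> * (\<delta> k + (\<Sum>j<k. coeff_G \<alpha> (k - j) * \<delta> j)) - \<tau> * beta \<alpha> \<tau> * coeff_M \<alpha> k * F 0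
      + \<tau> * F 0 * c powr (1 - \<alpha>) / Gamma (2 - \<alpha>)
      - \<tau> * (integral {0..c} (\<lambda>s. F s * (c - s) powr (- \<alpha>)) / Gamma (1 - \<alpha>))\<bar>
    \<le> B * \<tau>\<^sup>2 / Gamma (3 - \<alpha>) * ((2 - \<alpha>) * (q (Suc k) - q k) + (p (Suc k) - p k))
      + B / Gamma (2 - \<alpha>) * (\<tau>\<^sup>2 * (q (Suc k) - q k) + \<tau> ^ 3 * q k)"
proof -
  define J where "J t = integral {0..t} (\<lambda>s. F s * (t - s) powr (1 - \<alpha>)) / Gamma (2 - \<alpha>)" for t
  have e: "real k * \<tau> + \<tau> = real (Suc k) * \<tau>" "real k * \<tau> + \<tau> / 2 = c"
    by (auto simp: c_def algebra_simps)
  have "0 \<le> real k * \<tau>" "real k * \<tau> + \<tau> \<le> T" "0 \<in> {0..T}"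
    using assms(3,4) e by (auto simp del: of_nat_Suc intro: order_trans[of _ "real (Suc k) * \<tau>"])
  note 1 = fractional_midpoint_error[OF assms(1,2) this(1) assms(3) this(2) F F' cont B(1)[OF this(3)] B(2),
      unfolded e, folded J_def]
  note 2 = fractional_interpolation_error[OF assms(1-4) u F F' B, folded J_def]
  have M: "((real (Suc k) * \<tau>) powr (2 - \<alpha>) - (real k * \<tau>) powr (2 - \<alpha>)) / Gamma (3 - \<alpha>)
      = \<tau> * beta \<alpha> \<tau> * coeff_M \<alpha> k"
  proof -
    have "(real m * \<tau>) powr (2 - \<alpha>) = real m powr (2 - \<alpha>) * (\<tau> * \<tau> powr (1 - \<alpha>))" for m
      using assms(3) powr_add[of \<tau> 1 "1 - \<alpha>"] by (simp add: powr_mult)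
    then show ?thesis
      by (simp only: beta_def coeff_M_def) (simp add: algebra_simps diff_divide_distrib)
  qed
  have M': "F 0 * ((real (Suc k) * \<tau>) powr (2 - \<alpha>) - (real k * \<tau>) powr (2 - \<alpha>)) / Gamma (3 - \<alpha>)
      = \<tau> * beta \<alpha> \<tau> * coeff_M \<alpha> k * F 0"
    unfolding M[symmetric] by simp
  have T: "\<tau> * (A - F 0 * C / G) = \<tau> * A - \<tau> * F 0 * C / G" for A C G
    by (simp add: algebra_simps)
  show ?thesis
    using 1 2 unfolding \<delta>_def q_def p_def M' T by linarith
qed

section \<open>Truncation error\<close>

lemma C_rect_dx:
  assumes "C_rect (Suc n) L T u" "x \<in> {0..L}" "t \<in> {0..T}"
  shows "((\<lambda>y. u y t) has_real_derivative dx L u x t) (at x within {0..L})"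
  using assms by (auto simp: dx_def ivl_deriv_def has_real_derivative_iff_has_vector_derivative
      vector_derivative_works[symmetric])

lemma C_rect_dt:
  assumes "C_rect (Suc n) L T u" "x \<in> {0..L}" "t \<in> {0..T}"
  shows "((\<lambda>s. u x s) has_real_derivative dt T u x t) (at t within {0..T})"
  using assms by (auto simp: dt_def ivl_deriv_def has_real_derivative_iff_has_vector_derivative
      vector_derivative_works[symmetric])

lemma C_rect_continuous_on:
  "C_rect n L T u \<Longrightarrow> continuous_on ({0..L} \<times> {0..T}) (\<lambda>(x, t). u x t)"
  by (cases n) auto

lemma C_rect_bounded:
  assumes "C_rect n L T u"
  obtains B where "\<And>x t. x \<in> {0..L} \<Longrightarrow> t \<in> {0..T} \<Longrightarrow> \<bar>u x t\<bar> \<le> B"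
proof -
  have "compact ((\<lambda>(x, t). u x t) ` ({0..L} \<times> {0..T}))"
    by (intro compact_continuous_image C_rect_continuous_on[OF assms] compact_Times) auto
  then obtain B where B: "\<And>y. y \<in> (\<lambda>(x, t). u x t) ` ({0..L} \<times> {0..T}) \<Longrightarrow> norm y \<le> B"
    by (meson bounded_iff compact_imp_bounded)
  show thesis
    by (rule that[of B]) (use B in \<open>force simp: image_iff\<close>)
qed

lemma C_rect_continuous_on_time:
  assumes "C_rect n L T u" "x \<in> {0..L}"
  shows "continuous_on {0..T} (u x)"
proof -
  have "continuous_on {0..T} (\<lambda>t. (\<lambda>(x, t). u x t) (x, t))"
    using assms(2) by (intro continuous_on_compose2[OF C_rect_continuous_on[OF assms(1)]] continuous_intros) auto
  then show ?thesis by simp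
qed

lemma ivl_deriv_cong:
  assumes "x \<in> {a..b}" "\<And>y. y \<in> {a..b} \<Longrightarrow> g y = g' y"
  shows "ivl_deriv a b g x = ivl_deriv a b g' x"
proof -
  have "(g has_vector_derivative D) (at x within {a..b}) \<longleftrightarrow> (g' has_vector_derivative D) (at x within {a..b})" for D
    using assms has_vector_derivative_transform[of x "{a..b}" g g' D] has_vector_derivative_transform[of x "{a..b}" g' g D]
    by auto
  then show ?thesis by (simp add: ivl_deriv_def vector_derivative_def)
qed

text \<open>At \<open>t = 0\<close> the Caputo integral runs over a single point and vanishes, so
  the equation gives the claim. \<open>\<phi>\<close> agrees with the solution only on
  \<open>{0..L}\<close>, which suffices because derivatives are taken within that interval.\<close>

lemma psi_eq_dt:
  assumes "mim_solution \<alpha> L T f \<phi> u" "x \<in> {0..L}" "0 \<le> T"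
  shows "psi L f \<phi> x = dt T u x 0"
proof -
  have "ivl_deriv 0 L \<phi> y = dx L u y 0" if "y \<in> {0..L}" for y
    unfolding dx_def using that assms(1) by (intro ivl_deriv_cong) (auto simp: mim_solution_def)
  then have "ivl_deriv 0 L (ivl_deriv 0 L \<phi>) x = dx L (dx L u) x 0"
    unfolding dx_def[of L "dx L u"] using assms(2) by (intro ivl_deriv_cong) auto
  moreover have "dt T u x 0 + caputo \<alpha> T u x 0 = dx L (dx L u) x 0 + f x 0"
    using assms by (auto simp: mim_solution_def)
  moreover have "caputo \<alpha> T u x 0 = 0" by (simp add: caputo_def)
  ultimately show ?thesis by (simp add: psi_def)
qed

section \<open>Taylor estimates for the terms without memory\<close>

lemma midpoint_average_error:
  fixes g g' g'' :: "real \<Rightarrow> real"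
  assumes "0 \<le> a" "0 \<le> \<tau>" "a + \<tau> \<le> T"
    and g: "\<And>s. s \<in> {0..T} \<Longrightarrow> (g has_real_derivative g' s) (at s within {0..T})"
    and g': "\<And>s. s \<in> {0..T} \<Longrightarrow> (g' has_real_derivative g'' s) (at s within {0..T})"
    and B: "\<And>s. s \<in> {0..T} \<Longrightarrow> \<bar>g'' s\<bar> \<le> B"
  shows "\<bar>g (a + \<tau>) + g a - 2 * g (a + \<tau> / 2)\<bar> \<le> B * \<tau>\<^sup>2"
proof -
  define F where "F i = (if i = 0 then g else if i = 1 then g' else g'')" for i :: nat
  define c where "c = a + \<tau> / 2"
  have "norm (F 0 z - (\<Sum>i\<le>1. F i c * (z - c) ^ i / fact i)) \<le> B * norm (z - c) ^ Suc 1 / fact 1"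
    if "z \<in> {0..T}" for z
    using assms that by (intro field_Taylor[of "{0..T}"]) (auto simp: F_def c_def le_Suc_eq)
  then have *: "\<bar>g z - (g c + g' c * (z - c))\<bar> \<le> B * (z - c)\<^sup>2" if "z \<in> {0..T}" for z
    using that by (simp add: F_def power2_eq_square)
  have "\<bar>g (a + \<tau>) - (g c + g' c * (\<tau> / 2))\<bar> \<le> B * (\<tau> / 2)\<^sup>2"
    "\<bar>g a - (g c - g' c * (\<tau> / 2))\<bar> \<le> B * (\<tau> / 2)\<^sup>2"
    using *[of "a + \<tau>"] *[of a] assms(1-3) by (auto simp: c_def power2_eq_square)
  moreover have "2 * (B * (\<tau> / 2)\<^sup>2) \<le> B * \<tau>\<^sup>2"
    using B[of a] assms(1-3) by (simp add: power2_eq_square)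
  ultimately show ?thesis unfolding c_def[symmetric] by linarith
qed

lemma midpoint_difference_error:
  fixes g g' g'' g''' :: "real \<Rightarrow> real"
  assumes "0 \<le> a" "0 \<le> \<tau>" "a + \<tau> \<le> T"
    and g: "\<And>s. s \<in> {0..T} \<Longrightarrow> (g has_real_derivative g' s) (at s within {0..T})"
    and g': "\<And>s. s \<in> {0..T} \<Longrightarrow> (g' has_real_derivative g'' s) (at s within {0..T})"
    and g'': "\<And>s. s \<in> {0..T} \<Longrightarrow> (g'' has_real_derivative g''' s) (at s within {0..T})"
    and B: "\<And>s. s \<in> {0..T} \<Longrightarrow> \<bar>g''' s\<bar> \<le> B"
  shows "\<bar>g (a + \<tau>) - g a - \<tau> * g' (a + \<tau> / 2)\<bar> \<le> B * \<tau> ^ 3"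
proof -
  define F where "F i = (if i = 0 then g else if i = 1 then g' else if i = 2 then g'' else g''')" for i :: nat
  define c where "c = a + \<tau> / 2"
  have "norm (F 0 z - (\<Sum>i\<le>2. F i c * (z - c) ^ i / fact i)) \<le> B * norm (z - c) ^ Suc 2 / fact 2"
    if "z \<in> {0..T}" for z
    using assms that by (intro field_Taylor[of "{0..T}"]) (auto simp: F_def c_def numeral_2_eq_2 le_Suc_eq)
  then have *: "\<bar>g z - (g c + g' c * (z - c) + g'' c * (z - c)\<^sup>2 / 2)\<bar> \<le> B * \<bar>z - c\<bar> ^ 3 / 2" if "z \<in> {0..T}" for z
    using that by (simp add: F_def numeral_2_eq_2 numeral_3_eq_3)
  have "\<bar>g (a + \<tau>) - (g c + g' c * (\<tau> / 2) + g'' c * (\<tau> / 2)\<^sup>2 / 2)\<bar> \<le> B * (\<tau> / 2) ^ 3 / 2"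
    "\<bar>g a - (g c - g' c * (\<tau> / 2) + g'' c * (\<tau> / 2)\<^sup>2 / 2)\<bar> \<le> B * (\<tau> / 2) ^ 3 / 2"
    using *[of "a + \<tau>"] *[of a] assms(1-3) by (auto simp: c_def)
  moreover have "\<tau> * g' c = 2 * (g' c * (\<tau> / 2))" by simp
  moreover have "B * (\<tau> / 2) ^ 3 \<le> B * \<tau> ^ 3"
    using B[of a] assms(1-3) by (intro mult_left_mono power_mono) auto
  ultimately show ?thesis unfolding c_def[symmetric] by linarith
qed

lemma second_difference_error:
  fixes g g1 g2 g3 g4 :: "real \<Rightarrow> real"
  assumes "0 \<le> x - h" "0 \<le> h" "x + h \<le> L"
    and g: "\<And>s. s \<in> {0..L} \<Longrightarrow> (g has_real_derivative g1 s) (at s within {0..L})"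
    and g1: "\<And>s. s \<in> {0..L} \<Longrightarrow> (g1 has_real_derivative g2 s) (at s within {0..L})"
    and g2: "\<And>s. s \<in> {0..L} \<Longrightarrow> (g2 has_real_derivative g3 s) (at s within {0..L})"
    and g3: "\<And>s. s \<in> {0..L} \<Longrightarrow> (g3 has_real_derivative g4 s) (at s within {0..L})"
    and B: "\<And>s. s \<in> {0..L} \<Longrightarrow> \<bar>g4 s\<bar> \<le> B"
  shows "\<bar>g (x + h) - 2 * g x + g (x - h) - h\<^sup>2 * g2 x\<bar> \<le> B * h ^ 4"
proof -
  define F where "F i = (if i = 0 then g else if i = 1 then g1 else if i = 2 then g2 else if i = 3 then g3 else g4)" for i :: nat
  have "norm (F 0 z - (\<Sum>i\<le>3. F i x * (z - x) ^ i / fact i)) \<le> B * norm (z - x) ^ Suc 3 / fact 3"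
    if "z \<in> {0..L}" for z
    using assms that by (intro field_Taylor[of "{0..L}"]) (auto simp: F_def numeral_2_eq_2 numeral_3_eq_3 le_Suc_eq)
  then have *: "\<bar>g z - (g x + g1 x * (z - x) + g2 x * (z - x)\<^sup>2 / 2 + g3 x * (z - x) ^ 3 / 6)\<bar> \<le> B * \<bar>z - x\<bar> ^ 4 / 6" if "z \<in> {0..L}" for z
    using that by (simp add: F_def eval_nat_numeral)
  have "\<bar>g (x + h) - (g x + g1 x * h + g2 x * h\<^sup>2 / 2 + g3 x * h ^ 3 / 6)\<bar> \<le> B * h ^ 4 / 6"
    "\<bar>g (x - h) - (g x - g1 x * h + g2 x * h\<^sup>2 / 2 - g3 x * h ^ 3 / 6)\<bar> \<le> B * h ^ 4 / 6"
    using *[of "x + h"] *[of "x - h"] assms(1-3) by auto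
  moreover have "0 \<le> B * h ^ 4"
    using B[of x] assms(1-3) by simp
  ultimately show ?thesis unfolding mult.commute[of "h\<^sup>2"] by linarith
qed

text \<open>All terms of the scheme that contain the grid function, written in increments as the
  energy estimate requires; \<open>\<kappa>\<close> stands for
  \<open>\<tau> / (2 * h\<^sup>2)\<close>. Linearity lets the same expression serve the exact
  solution, the numerical one and the error.\<close>

definition cn_lhs :: "real \<Rightarrow> real \<Rightarrow> (nat \<Rightarrow> real) \<Rightarrow> (nat \<Rightarrow> nat \<Rightarrow> real) \<Rightarrow> nat \<Rightarrow> nat \<Rightarrow> real" where
  "cn_lhs \<beta> \<kappa> G e i k =
      (1 + \<beta>) * (e i (Suc k) - e i k) + \<beta> * (\<Sum>j<k. G (k - j) * (e i (Suc j) - e i j))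
      - \<kappa> * ((e (i + 1) (Suc k) + e (i + 1) k) - 2 * (e i (Suc k) + e i k)
          + (e (i - 1) (Suc k) + e (i - 1) k))"

lemma cn_lhs_diff:
  "cn_lhs \<beta> \<kappa> G (\<lambda>i k. a i k - b i k) i k = cn_lhs \<beta> \<kappa> G a i k - cn_lhs \<beta> \<kappa> G b i k"
proof -
  have "(\<Sum>j<k. G (k - j) * ((a i (Suc j) - b i (Suc j)) - (a i j - b i j)))
      = (\<Sum>j<k. G (k - j) * (a i (Suc j) - a i j)) - (\<Sum>j<k. G (k - j) * (b i (Suc j) - b i j))"
    by (simp add: sum_subtractf[symmetric] algebra_simps)
  then show ?thesis unfolding cn_lhs_def by (simp only:) (simp add: algebra_simps)
qed

text \<open>Summation by parts links the increments of the energy estimate to the nodal values of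
  the scheme. The initial value is arbitrary here, since this is applied to \<open>U\<close>; hence
  the term with \<open>x 0\<close>.\<close>

lemma memory_sum_eq:
  fixes G x :: "nat \<Rightarrow> real"
  shows "(\<Sum>j<k. G (k - j) * (x (Suc j) - x j))
    = (if k \<ge> 1 then G 1 * x k - G k * x 0 else 0) - (\<Sum>j\<in>{1..<k}. (G (k - j) - G (k - j + 1)) * x j)"
proof (cases k)
  case (Suc n)
  have 1: "(\<Sum>j<Suc n. G (Suc n - j) * x (Suc j)) = G 1 * x (Suc n) + (\<Sum>j<n. G (Suc n - j) * x (Suc j))"
    by simp
  have 2: "(\<Sum>j<Suc n. G (Suc n - j) * x j) = G (Suc n) * x 0 + (\<Sum>j<n. G (n - j) * x (Suc j))"
    by (subst sum.lessThan_Suc_shift) simp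
  have 3: "(\<Sum>j\<in>{1..<Suc n}. (G (Suc n - j) - G (Suc n - j + 1)) * x j)
      = (\<Sum>j<n. (G (n - j) - G (n - j + 1)) * x (Suc j))"
    by (rule sum.reindex_bij_witness[of _ Suc "\<lambda>j. j - 1"]) auto
  have 4: "(\<Sum>j<n. G (Suc n - j) * x (Suc j)) = (\<Sum>j<n. G (n - j + 1) * x (Suc j))"
    by (intro sum.cong) (auto simp: Suc_diff_le)
  show ?thesis
    unfolding Suc right_diff_distrib sum_subtractf 1 2 3 4 
    by (simp add: left_diff_distrib sum_subtractf)
qed simp

lemma cn_scheme_lhs:
  fixes L T :: real and M N :: nat
  defines "h \<equiv> L / real M" and "\<tau> \<equiv> T / real N"
  assumes "cn_scheme \<alpha> L T f \<phi> M N U" "i \<in> {1..M-1}" "k < N"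
  shows "cn_lhs (beta \<alpha> \<tau>) (\<tau> / (2 * h\<^sup>2)) (coeff_G \<alpha>) U i k
    = \<tau> * beta \<alpha> \<tau> * coeff_M \<alpha> k * psi L f \<phi> (real i * h)
      + \<tau> * f (real i * h) ((real k + 1/2) * \<tau>)
      - \<tau> * psi L f \<phi> (real i * h) * ((real k + 1/2) * \<tau>) powr (1 - \<alpha>) / Gamma (2 - \<alpha>)"
proof -
  define \<beta> \<kappa> where "\<beta> = beta \<alpha> \<tau>" and "\<kappa> = \<tau> / (2 * h\<^sup>2)"
  have \<kappa>2: "\<tau> / h\<^sup>2 = 2 * \<kappa>" by (simp add: \<kappa>_def)
  have "- \<kappa> * U (i + 1) (k + 1) + (2 * \<kappa> + 1 + \<beta>) * U i (k + 1) - \<kappa> * U (i - 1) (k + 1)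
      = \<kappa> * U (i + 1) k
          + (- (2 * \<kappa>) + 1 + \<beta> - (if k \<ge> 1 then \<beta> * coeff_G \<alpha> 1 else 0)) * U i k
          + \<kappa> * U (i - 1) k
          + \<beta> * (\<Sum>j\<in>{1..<k}. (coeff_G \<alpha> (k - j) - coeff_G \<alpha> (k - j + 1)) * U i j)
          + (if k \<ge> 1 then \<beta> * coeff_G \<alpha> k * U i 0 else 0)
          + \<tau> * \<beta> * coeff_M \<alpha> k * psi L f \<phi> (real i * h)
          + \<tau> * f (real i * h) ((real k + 1/2) * \<tau>)
          - \<tau> * psi L f \<phi> (real i * h) * ((real k + 1/2) * \<tau>) powr (1 - \<alpha>) / Gamma (2 - \<alpha>)"
    using assms(3-5) unfolding cn_scheme_def Let_def h_def[symmetric] \<tau>_def[symmetric]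
      \<beta>_def[symmetric] \<kappa>_def[symmetric] \<kappa>2 by auto
  then show ?thesis
    unfolding cn_lhs_def memory_sum_eq \<beta>_def[symmetric] \<kappa>_def[symmetric]
    by (simp add: algebra_simps split: if_splits)
qed

text \<open>The equation at the midpoint replaces \<open>f\<close>, and four errors remain: the
  central difference in time, the fractional terms, the time average of the second space derivative,
  and its difference quotient. The last two use fourth-order derivatives of \<open>u\<close>, one of
  them mixed.\<close>

lemma truncation_error:
  assumes \<alpha>: "0 < \<alpha>" "\<alpha> < 1" and h: "0 < h" "0 \<le> x - h" "x + h \<le> L"
    and \<tau>: "0 < \<tau>" "real (Suc k) * \<tau> \<le> T"
    and u: "C_rect 4 L T u" and sol: "mim_solution \<alpha> L T f \<phi> u"
    and B: "\<And>x t. x \<in> {0..L} \<Longrightarrow> t \<in> {0..T} \<Longrightarrow> \<bar>dt T (dt T u) x t\<bar> \<le> B"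
      "\<And>x t. x \<in> {0..L} \<Longrightarrow> t \<in> {0..T} \<Longrightarrow> \<bar>dt T (dt T (dt T u)) x t\<bar> \<le> B"
      "\<And>x t. x \<in> {0..L} \<Longrightarrow> t \<in> {0..T} \<Longrightarrow> \<bar>dt T (dt T (dx L (dx L u))) x t\<bar> \<le> B"
      "\<And>x t. x \<in> {0..L} \<Longrightarrow> t \<in> {0..T} \<Longrightarrow> \<bar>dx L (dx L (dx L (dx L u))) x t\<bar> \<le> B"
  defines "v \<equiv> (\<lambda>j. u x (real j * \<tau>))"
    and "\<beta> \<equiv> beta \<alpha> \<tau>"
    and "q \<equiv> (\<lambda>m. (real m * \<tau>) powr (1 - \<alpha>))"
    and "p \<equiv> (\<lambda>m. (real m * \<tau>) powr (2 - \<alpha>))"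
    and "c \<equiv> (real k + 1/2) * \<tau>"
  shows "\<bar>(1 + \<beta>) * (v (Suc k) - v k) + \<beta> * (\<Sum>j<k. coeff_G \<alpha> (k - j) * (v (Suc j) - v j))
      - \<tau> / (2 * h\<^sup>2) * ((u (x + h) (real (Suc k) * \<tau>) + u (x + h) (real k * \<tau>))
          - 2 * (v (Suc k) + v k)
          + (u (x - h) (real (Suc k) * \<tau>) + u (x - h) (real k * \<tau>)))
      - (\<tau> * \<beta> * coeff_M \<alpha> k * psi L f \<phi> x + \<tau> * f x c
        - \<tau> * psi L f \<phi> x * c powr (1 - \<alpha>) / Gamma (2 - \<alpha>))\<bar>
    \<le> B * (2 * \<tau> ^ 3 + \<tau> * h\<^sup>2
        + \<tau>\<^sup>2 / Gamma (3 - \<alpha>) * ((2 - \<alpha>) * (q (Suc k) - q k) + (p (Suc k) - p k))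
        + 1 / Gamma (2 - \<alpha>) * (\<tau>\<^sup>2 * (q (Suc k) - q k) + \<tau> ^ 3 * q k))"
proof -
  have u': "C_rect (Suc 3) L T u" "C_rect (Suc 2) L T (dt T u)" "C_rect (Suc 1) L T (dt T (dt T u))"
    "C_rect 1 L T (dt T (dt T (dt T u)))"
    "C_rect (Suc 2) L T (dx L u)" "C_rect (Suc 1) L T (dx L (dx L u))"
    "C_rect (Suc 0) L T (dt T (dx L (dx L u)))" "C_rect (Suc 0) L T (dx L (dx L (dx L u)))"
    using u by (auto simp: eval_nat_numeral)
  have x: "x \<in> {0..L}" "x + h \<in> {0..L}" "x - h \<in> {0..L}" using h by auto
  have kt: "0 \<le> real k * \<tau>" "real (Suc k) * \<tau> = real k * \<tau> + \<tau>" "c = real k * \<tau> + \<tau> / 2"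
    using \<tau>(1) by (auto simp: c_def algebra_simps)
  then have t: "real k * \<tau> \<in> {0..T}" "real (Suc k) * \<tau> \<in> {0..T}" "c \<in> {0..T}" "0 \<in> {0..T}"
    using \<tau> unfolding atLeastAtMost_iff by linarith+
  have T: "real k * \<tau> + \<tau> \<le> T" using \<tau> kt by linarith
  have psi: "psi L f \<phi> x = dt T u x 0"
    using psi_eq_dt[OF sol x(1)] t(4) by simp
  have pde: "\<tau> * f x c = \<tau> * dt T u x c + \<tau> * caputo \<alpha> T u x c - \<tau> * dx L (dx L u) x c"
  proof -
    have "dt T u x c + caputo \<alpha> T u x c = dx L (dx L u) x c + f x c"
      using sol x(1) t(3) unfolding mim_solution_def by blast
    then have "f x c = dt T u x c + caputo \<alpha> T u x c - dx L (dx L u) x c" by linarith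
    then show ?thesis by (simp only: distrib_left right_diff_distrib)
  qed
  have cap: "caputo \<alpha> T u x c = integral {0..c} (\<lambda>s. dt T u x s * (c - s) powr (- \<alpha>)) / Gamma (1 - \<alpha>)"
    by (simp add: caputo_def)
  have frac: "\<bar>\<beta> * (v (Suc k) - v k + (\<Sum>j<k. coeff_G \<alpha> (k - j) * (v (Suc j) - v j)))
      - \<tau> * \<beta> * coeff_M \<alpha> k * psi L f \<phi> x
      + \<tau> * psi L f \<phi> x * c powr (1 - \<alpha>) / Gamma (2 - \<alpha>) - \<tau> * caputo \<alpha> T u x c\<bar>
    \<le> B * \<tau>\<^sup>2 / Gamma (3 - \<alpha>) * ((2 - \<alpha>) * (q (Suc k) - q k) + (p (Suc k) - p k))
      + B / Gamma (2 - \<alpha>) * (\<tau>\<^sup>2 * (q (Suc k) - q k) + \<tau> ^ 3 * q k)"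
    unfolding cap psi v_def \<beta>_def q_def p_def unfolding c_def
    by (rule fractional_scheme_error[OF \<alpha> \<tau> C_rect_dt[OF u'(1) x(1)] C_rect_dt[OF u'(2) x(1)]
        C_rect_dt[OF u'(3) x(1)] C_rect_continuous_on_time[OF u'(4) x(1)] B(1)[OF x(1)] B(2)[OF x(1)]])
  have time: "\<bar>v (Suc k) - v k - \<tau> * dt T u x c\<bar> \<le> B * \<tau> ^ 3"
    unfolding v_def kt
    by (rule midpoint_difference_error[OF kt(1) less_imp_le[OF \<tau>(1)] T C_rect_dt[OF u'(1) x(1)]
          C_rect_dt[OF u'(2) x(1)] C_rect_dt[OF u'(3) x(1)] B(2)[OF x(1)]])
  have avg: "\<bar>dx L (dx L u) x (real (Suc k) * \<tau>) + dx L (dx L u) x (real k * \<tau>) - 2 * dx L (dx L u) x c\<bar> \<le> B * \<tau>\<^sup>2"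
    unfolding kt
    by (rule midpoint_average_error[OF kt(1) less_imp_le[OF \<tau>(1)] T C_rect_dt[OF u'(6) x(1)]
          C_rect_dt[OF u'(7) x(1)] B(3)[OF x(1)]])
  have "\<tau> / 2 * \<bar>dx L (dx L u) x (real (Suc k) * \<tau>) + dx L (dx L u) x (real k * \<tau>) - 2 * dx L (dx L u) x c\<bar>
      \<le> \<tau> / 2 * (B * \<tau>\<^sup>2)"
    using avg \<tau>(1) by (intro mult_left_mono) auto
  then have avg': "\<bar>\<tau> / 2 * dx L (dx L u) x (real (Suc k) * \<tau>) + \<tau> / 2 * dx L (dx L u) x (real k * \<tau>)
      - \<tau> * dx L (dx L u) x c\<bar> \<le> B * \<tau> ^ 3 / 2"
    using \<tau>(1) abs_mult_pos[of "\<tau> / 2"]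
    by (simp add: abs_mult_pos' algebra_simps power2_eq_square power3_eq_cube)
  have space: "\<bar>\<tau> / (2 * h\<^sup>2) * (u (x + h) t - 2 * u x t + u (x - h) t) - \<tau> / 2 * dx L (dx L u) x t\<bar>
      \<le> B * \<tau> * h\<^sup>2 / 2" if "t \<in> {0..T}" for t
  proof -
    have "\<bar>u (x + h) t - 2 * u x t + u (x - h) t - h\<^sup>2 * dx L (dx L u) x t\<bar> \<le> B * h ^ 4"
      by (rule second_difference_error[OF h(2) less_imp_le[OF h(1)] h(3)
            C_rect_dx[OF u'(1) _ that] C_rect_dx[OF u'(5) _ that] C_rect_dx[OF u'(6) _ that]
            C_rect_dx[OF u'(8) _ that] B(4)[OF _ that]])
    then have "\<tau> / (2 * h\<^sup>2) * \<bar>u (x + h) t - 2 * u x t + u (x - h) t - h\<^sup>2 * dx L (dx L u) x t\<bar>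
        \<le> \<tau> / (2 * h\<^sup>2) * (B * h ^ 4)"
      using \<tau>(1) by (intro mult_left_mono) auto
    moreover have "\<tau> / (2 * h\<^sup>2) * (B * h ^ 4) = B * \<tau> * h\<^sup>2 / 2"
      using h(1) by (simp add: field_simps eval_nat_numeral)
    moreover have "\<tau> / (2 * h\<^sup>2) * (u (x + h) t - 2 * u x t + u (x - h) t - h\<^sup>2 * dx L (dx L u) x t)
        = \<tau> / (2 * h\<^sup>2) * (u (x + h) t - 2 * u x t + u (x - h) t) - \<tau> / 2 * dx L (dx L u) x t"
      using h(1) by (simp add: right_diff_distrib)
    moreover have "\<tau> / (2 * h\<^sup>2) \<ge> 0" using \<tau>(1) by simp
    ultimately show ?thesis by (metis abs_mult abs_of_nonneg)
  qed
  have lap: "\<tau> / (2 * h\<^sup>2) * ((u (x + h) (real (Suc k) * \<tau>) + u (x + h) (real k * \<tau>))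
          - 2 * (v (Suc k) + v k)
          + (u (x - h) (real (Suc k) * \<tau>) + u (x - h) (real k * \<tau>)))
      = \<tau> / (2 * h\<^sup>2) * (u (x + h) (real (Suc k) * \<tau>) - 2 * u x (real (Suc k) * \<tau>) + u (x - h) (real (Suc k) * \<tau>))
      + \<tau> / (2 * h\<^sup>2) * (u (x + h) (real k * \<tau>) - 2 * u x (real k * \<tau>) + u (x - h) (real k * \<tau>))"
    unfolding distrib_left[symmetric] by (simp add: v_def algebra_simps)
  have mem: "(1 + \<beta>) * (v (Suc k) - v k) + \<beta> * (\<Sum>j<k. coeff_G \<alpha> (k - j) * (v (Suc j) - v j))
     = (v (Suc k) - v k) + \<beta> * (v (Suc k) - v k + (\<Sum>j<k. coeff_G \<alpha> (k - j) * (v (Suc j) - v j)))"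
    by (simp add: algebra_simps)
  \<comment> \<open>The time errors add up to 3/2 of \<open>B * \<tau> ^ 3\<close>; nonnegativity
    allows rounding this up to 2.\<close>
  have B0: "0 \<le> B * \<tau> ^ 3" using B(1)[OF x(1) t(1)] \<tau>(1) by simp
  have rhs: "B * (2 * \<tau> ^ 3 + \<tau> * h\<^sup>2
        + \<tau>\<^sup>2 / Gamma (3 - \<alpha>) * ((2 - \<alpha>) * (q (Suc k) - q k) + (p (Suc k) - p k))
        + 1 / Gamma (2 - \<alpha>) * (\<tau>\<^sup>2 * (q (Suc k) - q k) + \<tau> ^ 3 * q k))
     = 2 * (B * \<tau> ^ 3) + B * \<tau> * h\<^sup>2
      + (B * \<tau>\<^sup>2 / Gamma (3 - \<alpha>) * ((2 - \<alpha>) * (q (Suc k) - q k) + (p (Suc k) - p k))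
      + B / Gamma (2 - \<alpha>) * (\<tau>\<^sup>2 * (q (Suc k) - q k) + \<tau> ^ 3 * q k))"
    by (simp add: algebra_simps)
  \<comment> \<open>The triangle inequality with the terms as free variables: \<open>a\<close>,
    \<open>w\<close> and \<open>y\<close> make up \<open>\<tau> * f\<close> at the midpoint, while
    \<open>x1\<close> and \<open>x2\<close> are \<open>\<tau> / 2\<close> times the second space
    derivative at the two time levels.\<close>
  have "\<bar>d + m - (s2 + s1) - (n + (a + w - y) - p)\<bar> \<le> e1 + e2 + 2 * e3 + e4"
    if "\<bar>d - a\<bar> \<le> e1" "\<bar>m - n + p - w\<bar> \<le> e2" "\<bar>s1 - x1\<bar> \<le> e3" "\<bar>s2 - x2\<bar> \<le> e3"
      "\<bar>x2 + x1 - y\<bar> \<le> e4" for d m s1 s2 n a w y p x1 x2 e1 e2 e3 e4 :: real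
    using that by linarith
  note this[OF time frac space[OF t(1)] space[OF t(2)] avg']
  then show ?thesis
    unfolding lap mem rhs pde by (rule order_trans) (use B0 in simp)
qed

text \<open>The first step alone contributes order \<open>\<tau> powr (3 - \<alpha>)\<close>, but
  the increments of \<open>q\<close> and \<open>p\<close> telescope to powers of \<open>T\<close>.
  For the remaining \<open>\<tau> ^ 3\<close> terms, \<open>N\<close> steps of length
  \<open>\<tau>\<close> give a factor \<open>T\<close>, with \<open>q k\<close> at most
  \<open>T powr (1 - \<alpha>)\<close>.\<close>

lemma truncation_sum:
  fixes T \<tau> :: real
  assumes "\<alpha> < 1" "0 < \<tau>" "real N * \<tau> = T" "0 \<le> B"
  defines "q \<equiv> (\<lambda>m. (real m * \<tau>) powr (1 - \<alpha>))"
    and "p \<equiv> (\<lambda>m. (real m * \<tau>) powr (2 - \<alpha>))"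
  shows "(\<Sum>k<N. B * (2 * \<tau> ^ 3 + \<tau> * h\<^sup>2
        + \<tau>\<^sup>2 / Gamma (3 - \<alpha>) * ((2 - \<alpha>) * (q (Suc k) - q k) + (p (Suc k) - p k))
        + 1 / Gamma (2 - \<alpha>) * (\<tau>\<^sup>2 * (q (Suc k) - q k) + \<tau> ^ 3 * q k)))
    \<le> B * (2 * T + ((2 - \<alpha>) * T powr (1 - \<alpha>) + T powr (2 - \<alpha>)) / Gamma (3 - \<alpha>)
        + (T powr (1 - \<alpha>) + T * T powr (1 - \<alpha>)) / Gamma (2 - \<alpha>)) * (\<tau>\<^sup>2 + h\<^sup>2)" (is "?S \<le> B * ?C * _")
proof -
  have g: "Gamma (2 - \<alpha>) > 0" "Gamma (3 - \<alpha>) > 0"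
    using assms(1) by (auto intro!: Gamma_real_pos)
  have T: "0 \<le> T" using assms(2,3) by (metis less_imp_le mult_nonneg_nonneg of_nat_0_le_iff)
  have q: "(\<Sum>k<N. q (Suc k) - q k) = T powr (1 - \<alpha>)"
    unfolding sum_lessThan_telescope using assms(3) by (simp add: q_def)
  have p: "(\<Sum>k<N. p (Suc k) - p k) = T powr (2 - \<alpha>)"
    unfolding sum_lessThan_telescope using assms(3) by (simp add: p_def)
  have "q k \<le> T powr (1 - \<alpha>)" if "k < N" for k
  proof -
    have "real k * \<tau> \<le> real N * \<tau>" using that assms(2) by (intro mult_right_mono) auto
    then show ?thesis unfolding q_def using assms(1-3) by (intro powr_mono2) auto
  qed
  then have "(\<Sum>k<N. q k) \<le> (\<Sum>k<N. T powr (1 - \<alpha>))"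
    by (intro sum_mono) auto
  then have "\<tau> ^ 3 * (\<Sum>k<N. q k) \<le> \<tau> ^ 3 * (real N * T powr (1 - \<alpha>))"
    using assms(2) by (intro mult_left_mono) auto
  also have "\<dots> = \<tau>\<^sup>2 * (T * T powr (1 - \<alpha>))"
    unfolding assms(3)[symmetric] by (simp add: power2_eq_square power3_eq_cube)
  finally have qs: "\<tau> ^ 3 * (\<Sum>k<N. q k) \<le> \<tau>\<^sup>2 * (T * T powr (1 - \<alpha>))" .
  have "?S = B * (2 * (real N * \<tau>) * \<tau>\<^sup>2 + (real N * \<tau>) * h\<^sup>2
     + \<tau>\<^sup>2 / Gamma (3 - \<alpha>) * ((2 - \<alpha>) * (\<Sum>k<N. q (Suc k) - q k) + (\<Sum>k<N. p (Suc k) - p k))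
     + 1 / Gamma (2 - \<alpha>) * (\<tau>\<^sup>2 * (\<Sum>k<N. q (Suc k) - q k) + \<tau> ^ 3 * (\<Sum>k<N. q k)))"
    unfolding sum_distrib_left[symmetric] sum.distrib
    by (simp add: power2_eq_square power3_eq_cube)
  also have "\<dots> \<le> B * (2 * T * \<tau>\<^sup>2 + T * h\<^sup>2
     + \<tau>\<^sup>2 / Gamma (3 - \<alpha>) * ((2 - \<alpha>) * T powr (1 - \<alpha>) + T powr (2 - \<alpha>))
     + 1 / Gamma (2 - \<alpha>) * (\<tau>\<^sup>2 * T powr (1 - \<alpha>) + \<tau>\<^sup>2 * (T * T powr (1 - \<alpha>))))"
    unfolding q p assms(3) using g assms(4) qs
    by (intro mult_left_mono add_mono order_refl) auto
  also have "\<dots> = B * ?C * \<tau>\<^sup>2 + B * T * h\<^sup>2"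
    using g by (simp add: field_simps)
  also have "\<dots> \<le> B * ?C * \<tau>\<^sup>2 + B * ?C * h\<^sup>2"
  proof -
    have "0 \<le> ((2 - \<alpha>) * T powr (1 - \<alpha>) + T powr (2 - \<alpha>)) / Gamma (3 - \<alpha>)"
      "0 \<le> (T powr (1 - \<alpha>) + T * T powr (1 - \<alpha>)) / Gamma (2 - \<alpha>)"
      using g T assms(1) by (auto intro!: divide_nonneg_pos add_nonneg_nonneg mult_nonneg_nonneg)
    then have "T \<le> ?C" using T by linarith
    then show ?thesis using assms(4) by (intro add_left_mono mult_right_mono mult_left_mono) auto
  qed
  finally show ?thesis by (simp add: distrib_left)
qed

theorem theorem12:
  fixes \<alpha> L T :: real
    and f u :: "real \<Rightarrow> real \<Rightarrow> real"
    and \<phi> :: "real \<Rightarrow> real"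
  assumes "0 < L" and "0 < T"
    and "0 < \<alpha>" and "\<alpha> < 1"
    and "continuous_on ({0..L} \<times> {0..T}) (\<lambda>(x, t). f x t)"
    and "C_rect 4 L T u"
    and "mim_solution \<alpha> L T f \<phi> u"
  shows "\<exists>C>0. \<forall>(M::nat) (N::nat) (U :: nat \<Rightarrow> nat \<Rightarrow> real).
           M \<ge> 1 \<and> N \<ge> 1 \<and> cn_scheme \<alpha> L T f \<phi> M N U \<and>
           (\<forall>i\<le>M. U i 0 = \<phi> (real i * (L / real M))) \<longrightarrow>
           (\<forall>k. 1 \<le> k \<and> k \<le> N \<longrightarrow>
              grid_norm (L / real M) M
                (\<lambda>i. u (real i * (L / real M)) (real k * (T / real N)) - U i k)
              \<le> C * ((T / real N)\<^sup>2 + (L / real M)\<^sup>2))"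
proof -
  have C: "C_rect 2 L T (dt T (dt T u))" "C_rect 1 L T (dt T (dt T (dt T u)))"
    "C_rect 0 L T (dt T (dt T (dx L (dx L u))))" "C_rect 0 L T (dx L (dx L (dx L (dx L u))))"
    using assms(6) by (auto simp: eval_nat_numeral)
  obtain B1 where B1: "\<And>x t. x \<in> {0..L} \<Longrightarrow> t \<in> {0..T} \<Longrightarrow> \<bar>dt T (dt T u) x t\<bar> \<le> B1"
    using C_rect_bounded[OF C(1)] by blast
  obtain B2 where B2: "\<And>x t. x \<in> {0..L} \<Longrightarrow> t \<in> {0..T} \<Longrightarrow> \<bar>dt T (dt T (dt T u)) x t\<bar> \<le> B2"
    using C_rect_bounded[OF C(2)] by blast
  obtain B3 where B3: "\<And>x t. x \<in> {0..L} \<Longrightarrow> t \<in> {0..T} \<Longrightarrow> \<bar>dt T (dt T (dx L (dx L u))) x t\<bar> \<le> B3"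
    using C_rect_bounded[OF C(3)] by blast
  obtain B4 where B4: "\<And>x t. x \<in> {0..L} \<Longrightarrow> t \<in> {0..T} \<Longrightarrow> \<bar>dx L (dx L (dx L (dx L u))) x t\<bar> \<le> B4"
    using C_rect_bounded[OF C(4)] by blast
  define B where "B = \<bar>B1\<bar> + \<bar>B2\<bar> + \<bar>B3\<bar> + \<bar>B4\<bar>"
  have B: "\<And>x t. x \<in> {0..L} \<Longrightarrow> t \<in> {0..T} \<Longrightarrow> \<bar>dt T (dt T u) x t\<bar> \<le> B"
      "\<And>x t. x \<in> {0..L} \<Longrightarrow> t \<in> {0..T} \<Longrightarrow> \<bar>dt T (dt T (dt T u)) x t\<bar> \<le> B"
      "\<And>x t. x \<in> {0..L} \<Longrightarrow> t \<in> {0..T} \<Longrightarrow> \<bar>dt T (dt T (dx L (dx L u))) x t\<bar> \<le> B"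
      "\<And>x t. x \<in> {0..L} \<Longrightarrow> t \<in> {0..T} \<Longrightarrow> \<bar>dx L (dx L (dx L (dx L u))) x t\<bar> \<le> B"
    using B1 B2 B3 B4 unfolding B_def by (smt (verit))+
  have B0: "0 \<le> B" by (simp add: B_def)
  define C0 where "C0 = B * (2 * T + ((2 - \<alpha>) * T powr (1 - \<alpha>) + T powr (2 - \<alpha>)) / Gamma (3 - \<alpha>)
        + (T powr (1 - \<alpha>) + T * T powr (1 - \<alpha>)) / Gamma (2 - \<alpha>))"
  \<comment> \<open>The factor 2 comes from stability, and \<open>sqrt L\<close> is
    \<open>sqrt h * sqrt (real M)\<close>, the grid norm of the constant 1 up to one missing node.
    Adding 1 keeps \<open>C\<close> positive when \<open>B = 0\<close>.\<close>
  define C where "C = \<bar>2 * sqrt L * C0\<bar> + 1"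
  show ?thesis
  proof (intro exI[of _ C] conjI allI impI)
    show "C > 0" by (simp add: C_def)
    fix M N :: nat and U :: "nat \<Rightarrow> nat \<Rightarrow> real" and k :: nat
    assume "M \<ge> 1 \<and> N \<ge> 1 \<and> cn_scheme \<alpha> L T f \<phi> M N U \<and>
           (\<forall>i\<le>M. U i 0 = \<phi> (real i * (L / real M)))" and k: "1 \<le> k \<and> k \<le> N"
    then have M: "M \<ge> 1" and N: "N \<ge> 1" and S: "cn_scheme \<alpha> L T f \<phi> M N U"
      and U0: "\<And>i. i \<le> M \<Longrightarrow> U i 0 = \<phi> (real i * (L / real M))" by auto
    define h \<tau> where "h = L / real M" and "\<tau> = T / real N"
    have h: "h > 0" "real M * h = L" and \<tau>: "\<tau> > 0" "real N * \<tau> = T"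
      using assms(1,2) M N by (auto simp: h_def \<tau>_def)
    have "0 < Gamma (3 - \<alpha>)" using assms(4) by (intro Gamma_real_pos) auto
    then have \<beta>: "beta \<alpha> \<tau> \<ge> 0" by (simp add: beta_def)
    define v where "v i j = u (real i * h) (real j * \<tau>)" for i j
    define e where "e i j = v i j - U i j" for i j
    define q where "q m = (real m * \<tau>) powr (1 - \<alpha>)" for m
    define p where "p m = (real m * \<tau>) powr (2 - \<alpha>)" for m
    define r where "r k = B * (2 * \<tau> ^ 3 + \<tau> * h\<^sup>2
        + \<tau>\<^sup>2 / Gamma (3 - \<alpha>) * ((2 - \<alpha>) * (q (Suc k) - q k) + (p (Suc k) - p k))
        + 1 / Gamma (2 - \<alpha>) * (\<tau>\<^sup>2 * (q (Suc k) - q k) + \<tau> ^ 3 * q k))" for k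
    define R where "R i k = cn_lhs (beta \<alpha> \<tau>) (\<tau> / (2 * h\<^sup>2)) (coeff_G \<alpha>) e i k" for i k
    have tn: "real j * \<tau> \<in> {0..T}" if "j \<le> N" for j
    proof -
      have "real j * \<tau> \<le> real N * \<tau>" using that \<tau> by (intro mult_right_mono) auto
      then show ?thesis using \<tau> by simp
    qed
    have xn: "real i * h \<in> {0..L}" if "i \<le> M" for i
    proof -
      have "real i * h \<le> real M * h" using that h by (intro mult_right_mono) auto
      then show ?thesis using h by simp
    qed
    have init: "e i 0 = 0" if "i \<le> M" for i
      using assms(7) U0[OF that] xn[OF that] unfolding mim_solution_def by (simp add: e_def v_def h_def)
    \<comment> \<open>The model prescribes boundary values for positive times only; at
      \<open>j = 0\<close> the corner values agree because both sides equal
      \<open>\<phi>\<close>.\<close>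
    have bd: "e 0 j = 0" "e M j = 0" if "j \<le> N" for j
    proof -
      have "U 0 j = 0" "U M j = 0" using S that by (auto simp: cn_scheme_def Let_def)
      moreover have "u 0 (real j * \<tau>) = 0 \<and> u L (real j * \<tau>) = 0" if "j > 0"
      proof -
        have "real j * \<tau> \<in> {0<..T}" using tn[OF \<open>j \<le> N\<close>] that \<tau>(1) by simp
        then show ?thesis using assms(7) unfolding mim_solution_def by blast
      qed
      ultimately show "e 0 j = 0" "e M j = 0"
        using init[of 0] init[of M] h(2) by (cases "j = 0"; simp add: e_def v_def)+
    qed
    have r_nonneg: "0 \<le> r k" for k
    proof -
      have le: "real k * \<tau> \<le> real (Suc k) * \<tau>" "0 \<le> real k * \<tau>"
        using \<tau>(1) by (intro mult_right_mono mult_nonneg_nonneg; simp)+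
      have "q k \<le> q (Suc k)" "p k \<le> p (Suc k)" "0 \<le> q k"
        using assms(4) by (auto simp: q_def p_def simp del: of_nat_Suc intro!: powr_mono2 le)
      moreover have "0 < Gamma (2 - \<alpha>)" using assms(4) by (intro Gamma_real_pos) auto
      ultimately show ?thesis
        unfolding r_def using B0 \<tau>(1) assms(4) \<open>0 < Gamma (3 - \<alpha>)\<close>
        by (intro mult_nonneg_nonneg add_nonneg_nonneg divide_nonneg_pos) auto
    qed
    have R: "\<bar>R i k\<bar> \<le> r k" if i: "i \<in> {1..M-1}" and k: "k < N" for i k
    proof -
      have x: "real (i + 1) * h = real i * h + h" "real (i - 1) * h = real i * h - h"
        using i by (auto simp: of_nat_diff algebra_simps)
      have "0 \<le> real i * h - h" "real i * h + h \<le> L"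
        using xn[of "i + 1"] xn[of "i - 1"] i unfolding x by auto
      moreover have "real (Suc k) * \<tau> \<le> T" using tn[of "Suc k"] k by simp
      ultimately show ?thesis
        using truncation_error[OF assms(3,4) h(1) _ _ \<tau>(1) _ assms(6,7) B, of "real i * h" k]
        unfolding R_def e_def[abs_def] cn_lhs_diff
          cn_scheme_lhs[OF S i k, folded h_def \<tau>_def]
        unfolding cn_lhs_def v_def x r_def q_def p_def by simp
    qed
    have "L2_set (\<lambda>i. R i k) {1..M-1} \<le> sqrt (real M) * r k" if "k < N" for k
    proof -
      have "L2_set (\<lambda>i. R i k) {1..M-1} = L2_set (\<lambda>i. \<bar>R i k\<bar>) {1..M-1}"
        by (simp add: L2_set_def)
      also have "\<dots> \<le> L2_set (\<lambda>i. \<bar>r k\<bar>) {1..M-1}"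
        using R[OF _ that] by (intro L2_set_mono) force+
      also have "\<dots> = sqrt (real (M - 1)) * \<bar>r k\<bar>" by (simp add: L2_set_constant)
      also have "\<dots> \<le> sqrt (real M) * \<bar>r k\<bar>" by (intro mult_right_mono) auto
      also have "\<bar>r k\<bar> = r k" by (rule abs_of_nonneg[OF r_nonneg])
      finally show ?thesis .
    qed
    then have "L2_set (\<lambda>i. e i k) {1..M-1} \<le> 2 * (\<Sum>k<N. sqrt (real M) * r k)"
      using k init bd coeff_G_nonneg[OF assms(3,4)] coeff_G_decreasing[OF assms(3,4)]
        coeff_G_convex[OF assms(3,4)] coeff_G_1_2[OF assms(3,4)] \<tau>(1)
      by (intro crank_nicolson_stability[where e = e and R = R and \<beta> = "beta \<alpha> \<tau>"
            and \<kappa> = "\<tau> / (2 * h\<^sup>2)" and G = "coeff_G \<alpha>" and N = N] \<beta>) (auto simp: R_def cn_lhs_def)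
    also have "\<dots> = 2 * sqrt (real M) * (\<Sum>k<N. r k)"
      by (simp add: sum_distrib_left mult_ac)
    also have "\<dots> \<le> 2 * sqrt (real M) * (C0 * (\<tau>\<^sup>2 + h\<^sup>2))"
      unfolding r_def q_def p_def C0_def
      by (intro mult_left_mono truncation_sum assms(4) \<tau> B0) auto
    finally have "sqrt h * L2_set (\<lambda>i. e i k) {1..M-1} \<le> sqrt h * (2 * sqrt (real M) * (C0 * (\<tau>\<^sup>2 + h\<^sup>2)))"
      using h(1) by (intro mult_left_mono) auto
    also have "\<dots> = 2 * sqrt L * C0 * (\<tau>\<^sup>2 + h\<^sup>2)"
      unfolding h(2)[symmetric] real_sqrt_mult by (simp add: mult_ac)
    also have "\<dots> \<le> C * (\<tau>\<^sup>2 + h\<^sup>2)"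
      unfolding C_def by (intro mult_right_mono) auto
    also have "sqrt h * L2_set (\<lambda>i. e i k) {1..M-1} = grid_norm h M (\<lambda>i. e i k)"
      by (simp add: grid_norm_def L2_set_def sum_distrib_left[symmetric] real_sqrt_mult)
    finally show "grid_norm (L / real M) M
                (\<lambda>i. u (real i * (L / real M)) (real k * (T / real N)) - U i k)
              \<le> C * ((T / real N)\<^sup>2 + (L / real M)\<^sup>2)"
      by (simp add: e_def v_def h_def \<tau>_def)
  qed
qed

end
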